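(* Let $(\mathcal H, \langle \cdot, \cdot \rangle_{\mathcal H})$ and $(\mathcal V, \langle \cdot, \cdot \rangle_{\mathcal V})$ be any real Hilbert spaces, with $\mathcal H$ finite-dimensional and $\mathcal V$ separable. Let $k\ge2$ be an integer, $q\in[1,\infty)$ and $n:=\dim(\mathcal H)$. Then the norms $\|\cdot\|_{\mathcal G(k,q)(\mathcal V)}$ and $\|\cdot\|_{\mathcal D(k,q)(\mathcal V)}$ are equivalent. More precisely, for all $F\in\mathcal S_{\mathcal V}$ and all $\varepsilon\in(0,1)$, $$2^{\frac1q-1}\|F\|_{\mathcal G(k,q)(\mathcal V)}\le\|F\|_{\mathcal D(k,q)(\mathcal V)}\le\frac{2^{k+1}\,C_{k-1,n}^{k}}{\varepsilon^{k-1}}\,\|F\|_{L^q(\Omega;\mathcal V)}+(1+\varepsilon)\left\|D^kF\right\|_{L^q(\Omega;\mathcal H^{\otimes k}\otimes\mathcal V)},$$ where $$C_{1,n}:=18\sqrt e\,n,\qquad C_{\ell,n}:=2^{\sum_{m=1}^{\ell-1}\frac{\ell!}{(\ell-m)!}}\;C_{1,n}^{\sum_{m=1}^{\ell}\frac{\ell!}{(\ell-m)!}}\quad\text{for every integer }\ell\ge2.$$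
   Context: Setting. An isonormal Gaussian process over a real separable Hilbert space $\mathcal H$ is a centered Gaussian family $W=\{W(h):h\in\mathcal H\}$ of real random variables on a probability space $(\Omega,\mathcal F,\mathbb P)$ with $\mathbb E[W(h)W(g)]=\langle h,g\rangle_{\mathcal H}$ for all $h,g\in\mathcal H$. Throughout such a $W$ is fixed and $\mathcal F$ is the $\sigma$-field generated by $\{W(h):h\in\mathcal H\}$. $\mathcal S$ is the set of random variables $F=f(W(h_1),\dots,W(h_m))$ with $m\ge1$, $h_1,\dots,h_m\in\mathcal H$ and $f\in C^\infty(\mathbb R^m)$ such that $f$ and all its partial derivatives have at most polynomial growth. For an integer $k\ge1$, the $k$-th Malliavin derivative of such $F$ is the $\mathcal H^{\otimes k}$-valued random variable $$D^kF:=\sum_{i_1,\dots,i_k=1}^m\frac{\partial^k f}{\partial x_{i_1}\cdots\partial x_{i_k}}(W(h_1),\dots,W(h_m))\,h_{i_1}\otimes\cdots\otimes h_{i_k}$$ (independent of the chosen representation). $\mathcal S_{\mathcal V}$ is the set of $\mathcal V$-valued random variables $F=\sum_{j=1}^J F_j v_j$ with $J\ge 1$, $F_j\in\mathcal S$, $v_j\in\mathcal V$; for such $F$, $D^kF:=\sum_{j=1}^J(D^kF_j)\otimes v_j$, which takes values in the Hilbert tensor product $\mathcal H^{\otimes k}\otimes\mathcal V$. For a real separable Hilbert space $\mathcal K$, $\|G\|_{L^q(\Omega;\mathcal K)}:=(\mathbb E[\|G\|_{\mathcal K}^q])^{1/q}$. The graph norm and the full Sobolev norm are $$\|F\|_{\mathcal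 G(k,q)(\mathcal V)}:=\|F\|_{L^q(\Omega;\mathcal V)}+\|D^kF\|_{L^q(\Omega;\mathcal H^{\otimes k}\otimes\mathcal V)},$$ $$\|F\|_{\mathcal D(k,q)(\mathcal V)}^q:=\|F\|_{L^q(\Omega;\mathcal V)}^q+\sum_{\ell=1}^k\|D^\ell F\|_{L^q(\Omega;\mathcal H^{\otimes\ell}\otimes\mathcal V)}^q.$$
   Formalization: The formal theorem assumes n = dim(H) ≥ 1; for H = {0} the constants C_{ℓ,0} vanish and the stated upper bound fails for any non-zero constant F. *)

theory Defs
  imports "HOL-Probability.Probability"
begin

section \<open>Isonormal Gaussian processes\<close>

text \<open>Degenerate Gaussians (variance zero) are admitted, as they must be:
  \<open>W 0 = 0\<close> almost surely.\<close>

definition centered_gaussian :: "'a measure \<Rightarrow> ('a \<Rightarrow> real) \<Rightarrow> bool" where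
  "centered_gaussian M X \<longleftrightarrow> X \<in> borel_measurable M \<and>
     ((AE \<omega> in M. X \<omega> = 0) \<or>
      (\<exists>\<sigma>>0. distributed M lborel X (normal_density 0 \<sigma>)))"

locale isonormal_gaussian = prob_space M
  for M :: "'a measure" and W :: "'h::real_inner \<Rightarrow> 'a \<Rightarrow> real" +
  assumes gaussian_family:
      "finite A \<Longrightarrow> centered_gaussian M (\<lambda>\<omega>. \<Sum>h\<in>A. c h * W h \<omega>)"
    and covariance: "expectation (\<lambda>\<omega>. W h \<omega> * W g \<omega>) = h \<bullet> g"
    and generated_sigma_field:
      "sets M = sigma_sets (space M) {W h -` B \<inter> space M | h B. B \<in> sets borel}"


section \<open>Smooth functions on \<open>\<real>\<^sup>m\<close> of polynomial growth\<close>

text \<open>Points of \<open>\<real>\<^sup>m\<close> are given by the first \<open>m\<close> coordinates of a sequence, and functions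
  on \<open>\<real>\<^sup>m\<close> by functions of sequences that only depend on these coordinates. For such
  functions, continuity in the product topology on sequences is continuity on \<open>\<real>\<^sup>m\<close>.\<close>

definition partial_deriv :: "nat \<Rightarrow> ((nat \<Rightarrow> real) \<Rightarrow> real) \<Rightarrow> (nat \<Rightarrow> real) \<Rightarrow> real" where
  "partial_deriv i f x = deriv (\<lambda>t. f (x(i := t))) (x i)"

text \<open>For \<open>is = [i\<^sub>1, \<dots>, i\<^sub>k]\<close> this is
  \<open>\<partial>\<^sup>k f / \<partial>x\<^bsub>i\<^sub>1\<^esub> \<dots> \<partial>x\<^bsub>i\<^sub>k\<^esub>\<close>.\<close>

definition partial_derivs :: "nat list \<Rightarrow> ((nat \<Rightarrow> real) \<Rightarrow> real) \<Rightarrow> (nat \<Rightarrow> real) \<Rightarrow> real" where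
  "partial_derivs is f = foldr partial_deriv is f"

definition smooth_fun :: "nat \<Rightarrow> ((nat \<Rightarrow> real) \<Rightarrow> real) \<Rightarrow> bool" where
  "smooth_fun m f \<longleftrightarrow>
     (\<forall>x y. (\<forall>i<m. x i = y i) \<longrightarrow> f x = f y) \<and>
     (\<forall>is. set is \<subseteq> {..<m} \<longrightarrow>
        continuous_on UNIV (partial_derivs is f) \<and>
        (\<forall>i<m. \<forall>x. (\<lambda>t. partial_derivs is f (x(i := t))) differentiable (at (x i))))"

definition polynomial_growth :: "nat \<Rightarrow> ((nat \<Rightarrow> real) \<Rightarrow> real) \<Rightarrow> bool" where
  "polynomial_growth m g \<longleftrightarrow> (\<exists>(c::real) (p::nat). \<forall>x. \<bar>g x\<bar> \<le> c * (1 + L2_set x {..<m}) ^ p)"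

definition smooth_poly_growth :: "nat \<Rightarrow> ((nat \<Rightarrow> real) \<Rightarrow> real) \<Rightarrow> bool" where
  "smooth_poly_growth m f \<longleftrightarrow> smooth_fun m f \<and>
     (\<forall>is. set is \<subseteq> {..<m} \<longrightarrow> polynomial_growth m (partial_derivs is f))"


section \<open>The Hilbert tensor product \<open>\<H>\<^sup>\<otimes>\<^sup>k \<otimes> \<V>\<close>\<close>

text \<open>For finite-dimensional \<open>\<H>\<close>, the space \<open>\<H>\<^sup>\<otimes>\<^sup>k \<otimes> \<V>\<close> is realised as the space of
  \<open>k\<close>-linear maps \<open>\<H>\<^sup>k \<Rightarrow> \<V>\<close> (arguments collected in a list of length \<open>k\<close>) with the
  Hilbert-Schmidt inner product; \<open>h\<^sub>1 \<otimes> \<dots> \<otimes> h\<^sub>k \<otimes> v\<close> is the map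
  \<open>(x\<^sub>1, \<dots>, x\<^sub>k) \<mapsto> \<langle>h\<^sub>1, x\<^sub>1\<rangle> \<cdots> \<langle>h\<^sub>k, x\<^sub>k\<rangle> v\<close>. The case \<open>\<V> = \<real>\<close> gives \<open>\<H>\<^sup>\<otimes>\<^sup>k\<close>.
  The lemmas \<open>tensor_inner_elementary\<close> and \<open>tensor_expansion\<close> below show that the inner
  product has the values defining the Hilbert tensor product on elementary tensors, and that
  the elementary tensors span.\<close>

definition elementary_tensor :: "'h::real_inner list \<Rightarrow> 'h list \<Rightarrow> real" where
  "elementary_tensor hs = (\<lambda>xs. \<Prod>i<length hs. (hs ! i) \<bullet> (xs ! i))"

definition tensor_vec :: "('h list \<Rightarrow> real) \<Rightarrow> 'v::real_inner \<Rightarrow> 'h list \<Rightarrow> 'v" where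
  "tensor_vec T v = (\<lambda>xs. T xs *\<^sub>R v)"

definition basis_lists :: "nat \<Rightarrow> 'h::euclidean_space list set" where
  "basis_lists k = {bs. set bs \<subseteq> Basis \<and> length bs = k}"

definition tensor_inner ::
    "nat \<Rightarrow> ('h::euclidean_space list \<Rightarrow> 'v::real_inner) \<Rightarrow> ('h list \<Rightarrow> 'v) \<Rightarrow> real" where
  "tensor_inner k S T = (\<Sum>bs\<in>basis_lists k. S bs \<bullet> T bs)"

definition tensor_norm :: "nat \<Rightarrow> ('h::euclidean_space list \<Rightarrow> 'v::real_inner) \<Rightarrow> real" where
  "tensor_norm k T = sqrt (tensor_inner k T T)"

lemma finite_basis_lists: "finite (basis_lists k)"
  unfolding basis_lists_def by (rule finite_lists_length_eq) simp

lemma basis_lists_0: "basis_lists 0 = {[]}"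
  by (auto simp: basis_lists_def)

lemma sum_basis_lists_Suc:
  fixes F :: "'h::euclidean_space list \<Rightarrow> 'b::comm_monoid_add"
  shows "(\<Sum>bs\<in>basis_lists (Suc k). F bs) = (\<Sum>b\<in>Basis. \<Sum>bs\<in>basis_lists k. F (b # bs))"
proof -
  have "(\<Sum>bs\<in>basis_lists (Suc k). F bs)
      = (\<Sum>(b, bs)\<in>(Basis::'h set) \<times> basis_lists k. F (b # bs))"
    by (rule sum.reindex_bij_witness[where j = "\<lambda>bs. (hd bs, tl bs)" and i = "\<lambda>(b, bs). b # bs"])
      (auto simp: basis_lists_def length_Suc_conv)
  also have "\<dots> = (\<Sum>b\<in>Basis. \<Sum>bs\<in>basis_lists k. F (b # bs))"
    by (simp add: sum.cartesian_product)
  finally show ?thesis .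
qed

lemma elementary_tensor_Nil [simp]: "elementary_tensor [] xs = 1"
  by (simp add: elementary_tensor_def)

lemma elementary_tensor_Cons [simp]:
  "elementary_tensor (h # hs) (x # xs) = (h \<bullet> x) * elementary_tensor hs xs"
  by (simp add: elementary_tensor_def prod.lessThan_Suc_shift del: prod.lessThan_Suc)

lemma tensor_inner_elementary:
  fixes hs gs :: "'h::euclidean_space list" and v w :: "'v::real_inner"
  assumes "length hs = k" and "length gs = k"
  shows "tensor_inner k (tensor_vec (elementary_tensor hs) v) (tensor_vec (elementary_tensor gs) w)
       = (\<Prod>i<k. (hs ! i) \<bullet> (gs ! i)) * (v \<bullet> w)"
proof -
  have "(\<Sum>bs\<in>basis_lists k. elementary_tensor hs bs * elementary_tensor gs bs)
      = elementary_tensor hs gs"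
    using assms
  proof (induction k arbitrary: hs gs)
    case 0
    then show ?case by (simp add: basis_lists_0)
  next
    case (Suc k)
    then obtain h hs' g gs' where eq: "hs = h # hs'" "gs = g # gs'"
      and len: "length hs' = k" "length gs' = k"
      by (auto simp: length_Suc_conv)
    have "(\<Sum>bs\<in>basis_lists (Suc k). elementary_tensor hs bs * elementary_tensor gs bs)
        = (\<Sum>b\<in>Basis. (h \<bullet> b) * (g \<bullet> b) *
             (\<Sum>bs\<in>basis_lists k. elementary_tensor hs' bs * elementary_tensor gs' bs))"
      by (simp add: sum_basis_lists_Suc eq sum_distrib_left mult_ac)
    also have "\<dots> = (h \<bullet> g) * elementary_tensor hs' gs'"
      by (simp add: Suc.IH[OF len] euclidean_inner[of h g] sum_distrib_right)
    finally show ?case by (simp add: eq)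
  qed
  then show ?thesis
    using assms
    by (simp add: tensor_inner_def tensor_vec_def elementary_tensor_def mult_ac
        flip: sum_distrib_left sum_distrib_right)
qed

lemma elementary_tensor_basis:
  assumes "as \<in> basis_lists k" and "bs \<in> basis_lists k"
  shows "elementary_tensor as bs = (if as = bs then 1 else 0)"
  using assms
proof (induction k arbitrary: as bs)
  case 0
  then show ?case by (simp add: basis_lists_0)
next
  case (Suc k)
  then obtain a as' b bs' where "as = a # as'" "bs = b # bs'" "a \<in> Basis" "b \<in> Basis"
    "as' \<in> basis_lists k" "bs' \<in> basis_lists k"
    by (auto simp: basis_lists_def length_Suc_conv)
  then show ?case using Suc.IH[of as' bs'] by (auto simp: inner_Basis)
qed

lemma tensor_expansion:
  fixes T :: "'h::euclidean_space list \<Rightarrow> 'v::real_inner"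
  assumes "bs \<in> basis_lists k"
  shows "T bs = (\<Sum>as\<in>basis_lists k. tensor_vec (elementary_tensor as) (T as) bs)"
proof -
  have "(\<Sum>as\<in>basis_lists k. tensor_vec (elementary_tensor as) (T as) bs)
      = (\<Sum>as\<in>basis_lists k. if as = bs then T as else 0)"
    using assms by (intro sum.cong) (auto simp: tensor_vec_def elementary_tensor_basis)
  then show ?thesis using assms by (simp add: finite_basis_lists)
qed


section \<open>Smooth random variables and Malliavin derivatives\<close>

definition smooth_rep ::
    "'a measure \<Rightarrow> ('h \<Rightarrow> 'a \<Rightarrow> real) \<Rightarrow> ('a \<Rightarrow> real)
      \<Rightarrow> nat \<times> (nat \<Rightarrow> 'h) \<times> ((nat \<Rightarrow> real) \<Rightarrow> real) \<Rightarrow> bool" where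
  "smooth_rep M W F = (\<lambda>(m, h, f). m \<ge> 1 \<and> smooth_poly_growth m f \<and>
     (\<forall>\<omega>\<in>space M. F \<omega> = f (\<lambda>i. W (h i) \<omega>)))"

definition smooth_rvs :: "'a measure \<Rightarrow> ('h \<Rightarrow> 'a \<Rightarrow> real) \<Rightarrow> ('a \<Rightarrow> real) set" where
  "smooth_rvs M W = {F. \<exists>r. smooth_rep M W F r}"

text \<open>Different representations of \<open>F\<close> yield derivatives that agree almost surely, so the
  representation is picked by choice, here and in the vector-valued case.\<close>

definition malliavin_deriv ::
    "'a measure \<Rightarrow> ('h::real_inner \<Rightarrow> 'a \<Rightarrow> real) \<Rightarrow> nat \<Rightarrow> ('a \<Rightarrow> real) \<Rightarrow> 'a \<Rightarrow> 'h list \<Rightarrow> real" where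
  "malliavin_deriv M W k F = (case SOME r. smooth_rep M W F r of (m, h, f) \<Rightarrow>
     (\<lambda>\<omega> xs. \<Sum>is | set is \<subseteq> {..<m} \<and> length is = k.
        partial_derivs is f (\<lambda>i. W (h i) \<omega>) * elementary_tensor (map h is) xs))"

definition smooth_vec_rep ::
    "'a measure \<Rightarrow> ('h \<Rightarrow> 'a \<Rightarrow> real) \<Rightarrow> ('a \<Rightarrow> 'v::real_inner)
      \<Rightarrow> nat \<times> (nat \<Rightarrow> 'a \<Rightarrow> real) \<times> (nat \<Rightarrow> 'v) \<Rightarrow> bool" where
  "smooth_vec_rep M W F = (\<lambda>(J, G, v). J \<ge> 1 \<and> (\<forall>j<J. G j \<in> smooth_rvs M W) \<and>
     (\<forall>\<omega>\<in>space M. F \<omega> = (\<Sum>j<J. G j \<omega> *\<^sub>R v j)))"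

definition smooth_vec_rvs ::
    "'a measure \<Rightarrow> ('h \<Rightarrow> 'a \<Rightarrow> real) \<Rightarrow> ('a \<Rightarrow> 'v::real_inner) set" where
  "smooth_vec_rvs M W = {F. \<exists>r. smooth_vec_rep M W F r}"

definition malliavin_deriv_vec ::
    "'a measure \<Rightarrow> ('h::real_inner \<Rightarrow> 'a \<Rightarrow> real) \<Rightarrow> nat \<Rightarrow> ('a \<Rightarrow> 'v::real_inner)
      \<Rightarrow> 'a \<Rightarrow> 'h list \<Rightarrow> 'v" where
  "malliavin_deriv_vec M W k F = (case SOME r. smooth_vec_rep M W F r of (J, G, v) \<Rightarrow>
     (\<lambda>\<omega> xs. \<Sum>j<J. tensor_vec (malliavin_deriv M W k (G j) \<omega>) (v j) xs))"


section \<open>Graph norm and Sobolev norm\<close>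

text \<open>The argument \<open>N\<close> is the norm of the target Hilbert space.\<close>

definition Lq_norm :: "'a measure \<Rightarrow> real \<Rightarrow> ('b \<Rightarrow> real) \<Rightarrow> ('a \<Rightarrow> 'b) \<Rightarrow> real" where
  "Lq_norm M q N G = (\<integral>\<omega>. N (G \<omega>) powr q \<partial>M) powr (1 / q)"

definition graph_norm ::
    "'a measure \<Rightarrow> ('h::euclidean_space \<Rightarrow> 'a \<Rightarrow> real) \<Rightarrow> nat \<Rightarrow> real
      \<Rightarrow> ('a \<Rightarrow> 'v::real_inner) \<Rightarrow> real" where
  "graph_norm M W k q F =
     Lq_norm M q norm F + Lq_norm M q (tensor_norm k) (malliavin_deriv_vec M W k F)"

definition sobolev_norm ::
    "'a measure \<Rightarrow> ('h::euclidean_space \<Rightarrow> 'a \<Rightarrow> real) \<Rightarrow> nat \<Rightarrow> real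
      \<Rightarrow> ('a \<Rightarrow> 'v::real_inner) \<Rightarrow> real" where
  "sobolev_norm M W k q F =
     (Lq_norm M q norm F powr q +
      (\<Sum>l=1..k. Lq_norm M q (tensor_norm l) (malliavin_deriv_vec M W l F) powr q)) powr (1 / q)"

text \<open>The constants \<open>C\<^bsub>l,n\<^esub>\<close> for \<open>l \<ge> 1\<close>; the divisions in the exponents are exact.\<close>

definition sobolev_const :: "nat \<Rightarrow> nat \<Rightarrow> real" where
  "sobolev_const l n =
     (if l = 1 then 18 * sqrt (exp 1) * real n
      else 2 ^ (\<Sum>m=1..l-1. fact l div fact (l - m)) *
           (18 * sqrt (exp 1) * real n) ^ (\<Sum>m=1..l. fact l div fact (l - m)))"

end

theory Submission
  imports Defs
begin

text \<open>In an orthonormal basis of \<open>\<H>\<close>, the isonormal process is a standard Gaussian vector \<open>X\<close> in \<open>\<real>\<^sup>n\<close>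
  (\<open>coords_distribution\<close>, \<open>W_expansion\<close>), and a smooth random variable is almost surely \<open>\<Phi>(X)\<close> for a smooth
  function \<open>\<Phi>\<close> of polynomial growth. By the chain rule, its Malliavin derivatives are the derivative
  tensors of \<open>\<Phi>\<close> at \<open>X\<close>. So the theorem is about the numbers \<open>a\<^sub>l\<close>, the \<open>L\<^sup>q\<close> norms of the \<open>l\<close>-th derivative
  of \<open>\<Phi>\<close> under the Gaussian measure (\<open>malliavin_tower\<close>).

  Intermediate derivatives are controlled by Taylor's formula. For a function \<open>u\<close> and a signed
  step \<open>d\<close> in the direction of a basis vector,
  \<open>\<bar>u'(x)\<bar> \<le> (\<bar>u(x)\<bar> + \<bar>u(x - d)\<bar>) / \<bar>d\<bar> + \<bar>d\<bar> * \<integral>\<^sub>0\<^sup>1 \<bar>u''(x - r d)\<bar> dr\<close> (\<open>taylor_slice\<close>).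
  To take \<open>L\<^sup>q\<close> norms, the displaced terms must be compared with the undisplaced ones. A fixed
  translation does not map the Gaussian \<open>L\<^sup>q\<close> space boundedly into itself, but a translation by a
  length of at most \<open>1\<close> towards the origin does: it moves points to where the density is larger,
  except near the origin, and costs only a factor \<open>2\<surd>e\<close>, uniformly in \<open>q\<close> (\<open>std_normal_push_to_origin\<close>).
  Hence the sign of \<open>d\<close> is chosen as the sign of the coordinate of \<open>x\<close>. This works for every \<open>q \<ge> 1\<close>,
  including \<open>q = 1\<close>.

  Summation over the \<open>n\<close> directions yields
  \<open>a\<^bsub>l+1\<^esub> \<le> C\<^sup>2 / (4\<delta>) * a\<^sub>l + \<delta> * a\<^bsub>l+2\<^esub>\<close> for \<open>0 < \<delta> \<le> 1\<close> and \<open>C = 18\<surd>e n\<close> (\<open>one_step_interpolation\<close>). The rest is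
  arithmetic: iterating this inequality bounds \<open>a\<^sub>0 + \<dots> + a\<^bsub>k-1\<^esub>\<close> by
  \<open>2\<^bsup>k+1\<^esup> C\<^bsup>k(k-1)\<^esup> / \<epsilon>\<^bsup>k-1\<^esup> * a\<^sub>0 + \<epsilon> * a\<^sub>k\<close> (\<open>interpolation_sum\<close>), and \<open>C\<^bsup>k-1\<^esup>\<close> is at most \<open>C\<^bsub>k-1,n\<^esub>\<close>. The Sobolev norm is
  at most \<open>a\<^sub>0 + \<dots> + a\<^sub>k\<close>, and the lower bound is the midpoint convexity of the power \<open>q\<close>.\<close>

section \<open>Convexity of powers and bounds in \<open>L\<^sup>q\<close>\<close>

text \<open>Bernoulli's inequality for real exponents, read off from Young's inequality for the product
  \<open>y * 1\<close>. Both convexity statements below (two points and a probability average) are obtained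
  by averaging the tangent line at the mean, which also covers arguments equal to \<open>0\<close>.\<close>

lemma powr_ge_tangent_at_one:
  fixes y q :: real
  assumes "q \<ge> 1" and "y \<ge> 0"
  shows "1 + q * (y - 1) \<le> y powr q"
proof (cases "q = 1")
  case False
  then have "q > 1" using assms by simp
  then have "y * 1 \<le> y powr q / q + 1 powr (q / (q - 1)) / (q / (q - 1))"
    using assms by (intro Youngs_inequality) (auto simp: field_simps)
  then have "q * y \<le> q * (y powr q / q + 1 powr (q / (q - 1)) / (q / (q - 1)))"
    using \<open>q > 1\<close> by (intro mult_left_mono) auto
  also have "\<dots> = y powr q + (q - 1)" using \<open>q > 1\<close> by (simp add: field_simps)
  finally show ?thesis by (simp add: algebra_simps)
qed (use assms in auto)

lemma powr_ge_tangent: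
  fixes a q z :: real
  assumes "q \<ge> 1" and "a \<ge> 0" and "z > 0"
  shows "z powr q * (1 + q * (a / z - 1)) \<le> a powr q"
proof -
  have "z powr q * (1 + q * (a / z - 1)) \<le> z powr q * (a / z) powr q"
    using assms by (intro mult_left_mono powr_ge_tangent_at_one) auto
  also have "\<dots> = a powr q" using assms by (simp add: powr_divide)
  finally show ?thesis .
qed

lemma powr_two_point_convex:
  fixes a b q \<theta> :: real
  assumes "q \<ge> 1" "a \<ge> 0" "b \<ge> 0" "0 \<le> \<theta>" "\<theta> \<le> 1"
  shows "(\<theta> * a + (1 - \<theta>) * b) powr q \<le> \<theta> * a powr q + (1 - \<theta>) * b powr q"
proof (cases "\<theta> * a + (1 - \<theta>) * b = 0")
  case False
  define z where "z = \<theta> * a + (1 - \<theta>) * b"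
  have z: "z > 0" using False assms unfolding z_def by (smt (verit) mult_nonneg_nonneg)
  have "\<theta> * (a / z - 1) + (1 - \<theta>) * (b / z - 1) = (\<theta> * a + (1 - \<theta>) * b) / z - 1"
    by (simp add: add_divide_distrib diff_divide_distrib algebra_simps)
  also have "\<dots> = 0" using z by (simp flip: z_def)
  finally have *: "\<theta> * (a / z - 1) + (1 - \<theta>) * (b / z - 1) = 0" .
  have "\<theta> * (z powr q * (1 + q * (a / z - 1))) + (1 - \<theta>) * (z powr q * (1 + q * (b / z - 1)))
      \<le> \<theta> * a powr q + (1 - \<theta>) * b powr q"
    using assms z by (intro add_mono mult_left_mono powr_ge_tangent) auto
  also have "\<theta> * (z powr q * (1 + q * (a / z - 1))) + (1 - \<theta>) * (z powr q * (1 + q * (b / z - 1)))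
      = z powr q * (1 + q * (\<theta> * (a / z - 1) + (1 - \<theta>) * (b / z - 1)))"
    by (simp add: algebra_simps)
  finally show ?thesis by (simp add: * flip: z_def)
qed (use assms in auto)

text \<open>Jensen's inequality for the power \<open>q\<close>: the tangent at the mean \<open>z\<close> lies below the power and
  integrates to \<open>z powr q\<close>. The right-hand side is an extended nonnegative integral, so it may be
  infinite.\<close>

lemma powr_jensen:
  fixes f :: "'a \<Rightarrow> real"
  assumes "prob_space U" and "q \<ge> 1" and f0: "\<And>x. x \<in> space U \<Longrightarrow> 0 \<le> f x" and int: "integrable U f"
  shows "ennreal ((\<integral>x. f x \<partial>U) powr q) \<le> (\<integral>\<^sup>+x. ennreal (f x powr q) \<partial>U)"
proof -
  interpret prob_space U by fact
  define z where "z = (\<integral>x. f x \<partial>U)"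
  have "z \<ge> 0" unfolding z_def by (rule integral_nonneg_AE) (use f0 in auto)
  show ?thesis
  proof (cases "z = 0")
    case False
    with \<open>z \<ge> 0\<close> have z: "z > 0" by simp
    have meas [measurable]: "f \<in> borel_measurable U" using int by simp
    let ?t = "\<lambda>x. z powr q * (1 + q * (f x / z - 1))"
    have it: "integrable U ?t" using int by simp
    have "(\<integral>x. ?t x \<partial>U) = z powr q * (1 + q * (z / z - 1))"
      using int by (simp add: prob_space z_def)
    then have e: "(\<integral>x. ?t x \<partial>U) = z powr q" using z by simp
    show ?thesis
    proof (cases "integrable U (\<lambda>x. f x powr q)")
      case True
      have "(\<integral>x. ?t x \<partial>U) \<le> (\<integral>x. f x powr q \<partial>U)"
        using assms z True it by (intro integral_mono powr_ge_tangent) auto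
      then have "z powr q \<le> (\<integral>x. f x powr q \<partial>U)" by (simp only: e)
      then show ?thesis
        using True by (simp add: nn_integral_eq_integral flip: z_def)
    next
      case False
      have "\<not> (\<integral>\<^sup>+x. ennreal (f x powr q) \<partial>U) < top"
      proof
        assume *: "(\<integral>\<^sup>+x. ennreal (f x powr q) \<partial>U) < top"
        have "integrable U (\<lambda>x. f x powr q)"
        proof (rule integrableI_bounded)
          show "(\<lambda>x. f x powr q) \<in> borel_measurable U" by measurable
          show "(\<integral>\<^sup>+x. ennreal (norm (f x powr q)) \<partial>U) < \<infinity>"
            using * by (simp only: real_norm_def abs_of_nonneg powr_ge_zero infinity_ennreal_def)
        qed
        with False show False by blast
      qed
      then have "(\<integral>\<^sup>+x. ennreal (f x powr q) \<partial>U) = top"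
        using top.not_eq_extremum by blast
      then show ?thesis by simp
    qed
  qed (simp flip: z_def)
qed

text \<open>An upper bound for the \<open>L\<^sup>q\<close> norm, phrased with the nonnegative integral. Unlike
  \<^const>\<open>Lq_norm\<close>, whose Bochner integral is \<open>0\<close> on non-integrable functions, this predicate
  implies finiteness, so estimates can be chained without separate integrability arguments.\<close>

definition Lq_bounded :: "'a measure \<Rightarrow> real \<Rightarrow> ('a \<Rightarrow> real) \<Rightarrow> real \<Rightarrow> bool" where
  "Lq_bounded M q f s \<longleftrightarrow> f \<in> borel_measurable M \<and> (\<forall>x\<in>space M. 0 \<le> f x) \<and> 0 \<le> s \<and>
     (\<integral>\<^sup>+x. ennreal (f x powr q) \<partial>M) \<le> ennreal (s powr q)"

lemma Lq_bounded_mono: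
  assumes "Lq_bounded M q g s" and "q \<ge> 1" and "f \<in> borel_measurable M"
    and "\<And>x. x \<in> space M \<Longrightarrow> 0 \<le> f x" and "\<And>x. x \<in> space M \<Longrightarrow> f x \<le> g x" and "s \<le> t"
  shows "Lq_bounded M q f t"
proof -
  have "(\<integral>\<^sup>+x. ennreal (f x powr q) \<partial>M) \<le> (\<integral>\<^sup>+x. ennreal (g x powr q) \<partial>M)"
    using assms by (intro nn_integral_mono ennreal_leI powr_mono2) auto
  also have "\<dots> \<le> ennreal (s powr q)" using assms by (simp add: Lq_bounded_def)
  also have "\<dots> \<le> ennreal (t powr q)"
    using assms by (intro ennreal_leI powr_mono2) (auto simp: Lq_bounded_def)
  finally show ?thesis using assms by (auto simp: Lq_bounded_def)
qed

lemma Lq_bounded_cmult: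
  assumes "Lq_bounded M q f s" and "q \<ge> 1" and "c \<ge> 0"
  shows "Lq_bounded M q (\<lambda>x. c * f x) (c * s)"
proof -
  have [measurable]: "f \<in> borel_measurable M" using assms by (simp add: Lq_bounded_def)
  have "(\<integral>\<^sup>+x. ennreal ((c * f x) powr q) \<partial>M) = (\<integral>\<^sup>+x. ennreal (c powr q) * ennreal (f x powr q) \<partial>M)"
    using assms
    by (intro nn_integral_cong) (auto simp: Lq_bounded_def powr_mult simp flip: ennreal_mult)
  also have "\<dots> = ennreal (c powr q) * (\<integral>\<^sup>+x. ennreal (f x powr q) \<partial>M)"
    by (rule nn_integral_cmult) measurable
  also have "\<dots> \<le> ennreal (c powr q) * ennreal (s powr q)"
    using assms by (intro mult_left_mono) (auto simp: Lq_bounded_def)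
  also have "\<dots> = ennreal ((c * s) powr q)"
    using assms by (simp add: Lq_bounded_def powr_mult flip: ennreal_mult)
  finally show ?thesis using assms by (auto simp: Lq_bounded_def)
qed

lemma Lq_bounded_0_imp_AE:
  assumes "Lq_bounded M q f 0"
  shows "AE x in M. f x = 0"
proof -
  have [measurable]: "f \<in> borel_measurable M" using assms by (simp add: Lq_bounded_def)
  have "(\<integral>\<^sup>+x. ennreal (f x powr q) \<partial>M) = 0" using assms by (simp add: Lq_bounded_def)
  then have "AE x in M. ennreal (f x powr q) = 0"
    by (subst (asm) nn_integral_0_iff_AE) auto
  then show ?thesis by eventually_elim simp
qed

text \<open>Minkowski's inequality: \<open>(f + g) / (s + t)\<close> is the convex combination of \<open>f / s\<close> and \<open>g / t\<close>
  with weights \<open>s / (s + t)\<close> and \<open>t / (s + t)\<close>, both of which have \<open>L\<^sup>q\<close> norm at most \<open>1\<close>. A vanishing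
  bound means that the function vanishes almost everywhere, and is treated apart.\<close>

lemma Lq_bounded_add:
  assumes f: "Lq_bounded M q f s" and g: "Lq_bounded M q g t" and q: "q \<ge> 1"
  shows "Lq_bounded M q (\<lambda>x. f x + g x) (s + t)"
proof -
  have [measurable]: "f \<in> borel_measurable M" "g \<in> borel_measurable M"
    and st: "0 \<le> s" "0 \<le> t" using f g by (simp_all add: Lq_bounded_def)
  have "(\<integral>\<^sup>+x. ennreal ((f x + g x) powr q) \<partial>M) \<le> ennreal ((s + t) powr q)"
  proof -
    consider "s = 0" | "t = 0" | "s > 0" "t > 0" using st by fastforce
    then show ?thesis
    proof cases
      case 1
      have "(\<integral>\<^sup>+x. ennreal ((f x + g x) powr q) \<partial>M) = (\<integral>\<^sup>+x. ennreal (g x powr q) \<partial>M)"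
        by (rule nn_integral_cong_AE) (use Lq_bounded_0_imp_AE[OF f[unfolded 1]] in auto)
      then show ?thesis using g 1 by (simp add: Lq_bounded_def)
    next
      case 2
      have "(\<integral>\<^sup>+x. ennreal ((f x + g x) powr q) \<partial>M) = (\<integral>\<^sup>+x. ennreal (f x powr q) \<partial>M)"
        by (rule nn_integral_cong_AE) (use Lq_bounded_0_imp_AE[OF g[unfolded 2]] in auto)
      then show ?thesis using f 2 by (simp add: Lq_bounded_def)
    next
      case 3
      define m where "m = s + t"
      have m: "m > 0" using 3 by (simp add: m_def)
      define A where "A = m powr q * (s / m) / s powr q"
      define B where "B = m powr q * (t / m) / t powr q"
      have AB: "A \<ge> 0" "B \<ge> 0" using 3 m by (auto simp: A_def B_def)
      have tm: "1 - s / m = t / m" using m by (simp add: m_def field_simps)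
      have pw: "(f x + g x) powr q \<le> A * f x powr q + B * g x powr q" if "x \<in> space M" for x
      proof -
        have nn: "0 \<le> f x" "0 \<le> g x" using f g that by (auto simp: Lq_bounded_def)
        have "(s / m * (f x / s) + (1 - s / m) * (g x / t)) powr q
           \<le> s / m * (f x / s) powr q + (1 - s / m) * (g x / t) powr q"
          using 3 m nn q by (intro powr_two_point_convex) (auto simp: m_def)
        moreover have "s / m * (f x / s) + (1 - s / m) * (g x / t) = (f x + g x) / m"
          unfolding tm using 3 by (simp add: add_divide_distrib)
        ultimately have "((f x + g x) / m) powr q \<le> s / m * (f x / s) powr q + t / m * (g x / t) powr q"
          by (simp add: tm)
        then have "m powr q * ((f x + g x) / m) powr q
           \<le> m powr q * (s / m * (f x / s) powr q + t / m * (g x / t) powr q)"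
          by (intro mult_left_mono) auto
        moreover have "m powr q * ((f x + g x) / m) powr q = (f x + g x) powr q"
          using nn m by (simp add: powr_divide)
        moreover have "m powr q * (s / m * (f x / s) powr q + t / m * (g x / t) powr q)
           = A * f x powr q + B * g x powr q"
          using nn 3 by (simp add: A_def B_def powr_divide algebra_simps)
        ultimately show ?thesis by simp
      qed
      have "(\<integral>\<^sup>+x. ennreal ((f x + g x) powr q) \<partial>M)
          \<le> (\<integral>\<^sup>+x. ennreal A * ennreal (f x powr q) + ennreal B * ennreal (g x powr q) \<partial>M)"
        using AB pw
        by (intro nn_integral_mono) (auto simp flip: ennreal_mult ennreal_plus intro!: ennreal_leI)
      also have "\<dots> = ennreal A * (\<integral>\<^sup>+x. ennreal (f x powr q) \<partial>M)
          + ennreal B * (\<integral>\<^sup>+x. ennreal (g x powr q) \<partial>M)"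
        by (simp add: nn_integral_add nn_integral_cmult)
      also have "\<dots> \<le> ennreal A * ennreal (s powr q) + ennreal B * ennreal (t powr q)"
        using f g by (intro add_mono mult_left_mono) (auto simp: Lq_bounded_def)
      also have "\<dots> = ennreal (A * s powr q + B * t powr q)"
        using AB by (simp flip: ennreal_mult ennreal_plus)
      also have "A * s powr q + B * t powr q = m powr q * (s / m + t / m)"
        using 3 by (simp add: A_def B_def algebra_simps)
      also have "s / m + t / m = 1" using m tm by simp
      finally show ?thesis by (simp add: m_def)
    qed
  qed
  then show ?thesis using f g by (auto simp: Lq_bounded_def)
qed

lemma Lq_bounded_sum:
  assumes "finite I" and "\<And>i. i \<in> I \<Longrightarrow> Lq_bounded M q (f i) (s i)" and "q \<ge> 1"
  shows "Lq_bounded M q (\<lambda>x. \<Sum>i\<in>I. f i x) (\<Sum>i\<in>I. s i)"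
  using assms
proof (induction I)
  case empty
  then show ?case by (simp add: Lq_bounded_def)
next
  case (insert i I)
  then show ?case by (simp add: Lq_bounded_add)
qed

lemma Lq_bounded_Lq_norm:
  assumes "f \<in> borel_measurable M" "\<And>x. x \<in> space M \<Longrightarrow> 0 \<le> f x"
    and "integrable M (\<lambda>x. f x powr q)" and "q \<ge> 1"
  shows "Lq_bounded M q f (Lq_norm M q (\<lambda>x. x) f)"
proof -
  have "0 \<le> (\<integral>x. f x powr q \<partial>M)" by (rule integral_nonneg_AE) auto
  then have "Lq_norm M q (\<lambda>x. x) f powr q = (\<integral>x. f x powr q \<partial>M)"
    using assms by (simp add: Lq_norm_def powr_powr)
  moreover have "0 \<le> Lq_norm M q (\<lambda>x. x) f" by (simp add: Lq_norm_def)
  ultimately show ?thesis using assms by (auto simp: Lq_bounded_def nn_integral_eq_integral)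
qed

lemma Lq_norm_le_of_bounded:
  assumes "Lq_bounded M q f s" and "q \<ge> 1"
  shows "Lq_norm M q (\<lambda>x. x) f \<le> s"
proof -
  have "(\<integral>x. f x powr q \<partial>M) = enn2real (\<integral>\<^sup>+x. ennreal (f x powr q) \<partial>M)"
    using assms by (intro integral_eq_nn_integral) (auto simp: Lq_bounded_def)
  also have "\<dots> \<le> enn2real (ennreal (s powr q))"
    using assms by (intro enn2real_mono) (auto simp: Lq_bounded_def)
  finally have "(\<integral>x. f x powr q \<partial>M) \<le> s powr q" by simp
  then have "(\<integral>x. f x powr q \<partial>M) powr (1 / q) \<le> (s powr q) powr (1 / q)"
    using assms by (intro powr_mono2) (auto intro!: integral_nonneg_AE)
  also have "\<dots> = s" using assms by (simp add: powr_powr Lq_bounded_def)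
  finally show ?thesis by (simp add: Lq_norm_def)
qed

lemma powr_sum_le_sum:
  fixes a :: "'i \<Rightarrow> real"
  assumes "finite I" "\<And>i. i \<in> I \<Longrightarrow> 0 \<le> a i" "q \<ge> 1"
  shows "(\<Sum>i\<in>I. a i powr q) powr (1 / q) \<le> (\<Sum>i\<in>I. a i)"
proof -
  let ?S = "\<Sum>i\<in>I. a i"
  have S0: "0 \<le> ?S" using assms by (intro sum_nonneg) auto
  have "(\<Sum>i\<in>I. a i powr q) \<le> (\<Sum>i\<in>I. a i * ?S powr (q - 1))"
  proof (rule sum_mono)
    fix i assume i: "i \<in> I"
    have "a i powr q = a i * a i powr (q - 1)"
      using assms(2)[OF i] by (cases "a i = 0") (simp_all add: powr_diff)
    also have "\<dots> \<le> a i * ?S powr (q - 1)"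
      using assms i by (intro mult_left_mono powr_mono2 member_le_sum) auto
    finally show "a i powr q \<le> a i * ?S powr (q - 1)" .
  qed
  also have "\<dots> = ?S * ?S powr (q - 1)" by (simp add: sum_distrib_right)
  also have "\<dots> = ?S powr q" using S0 by (cases "?S = 0") (simp_all add: powr_diff)
  finally have "(\<Sum>i\<in>I. a i powr q) powr (1 / q) \<le> (?S powr q) powr (1 / q)"
    using assms by (intro powr_mono2) (auto intro!: sum_nonneg)
  also have "\<dots> = ?S" using S0 assms by (simp add: powr_powr)
  finally show ?thesis .
qed

text \<open>The lower bound of the theorem: convexity of the power \<open>q\<close> at the midpoint of \<open>a\<close> and \<open>b\<close>.\<close>

lemma half_power_mean_le:
  fixes a b r q :: real
  assumes "a \<ge> 0" "b \<ge> 0" "r \<ge> 0" "q \<ge> 1"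
  shows "2 powr (1 / q - 1) * (a + b) \<le> (a powr q + r + b powr q) powr (1 / q)"
proof -
  have "(1/2 * a + (1 - 1/2) * b) powr q \<le> 1/2 * a powr q + (1 - 1/2) * b powr q"
    using assms by (intro powr_two_point_convex) auto
  then have "2 * ((a + b) / 2) powr q \<le> a powr q + r + b powr q"
    using assms by (simp add: add_divide_distrib)
  then have "(2 * ((a + b) / 2) powr q) powr (1 / q) \<le> (a powr q + r + b powr q) powr (1 / q)"
    using assms by (intro powr_mono2) auto
  also have "(2 * ((a + b) / 2) powr q) powr (1 / q) = 2 powr (1 / q) * ((a + b) / 2)"
    using assms by (simp add: powr_mult powr_powr)
  also have "\<dots> = 2 powr (1 / q - 1) * (a + b)" by (simp add: powr_diff)
  finally show ?thesis .
qed

section \<open>Interpolation between the terms of a sequence\<close>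

text \<open>The three-term inequality bounds \<open>a (l+1)\<close> by both neighbours; here the lower neighbour is
  eliminated down to \<open>a 0\<close>. In the induction step the bound for \<open>a l\<close> is inserted with the parameter
  \<open>\<theta> = \<delta> / Q\<^sup>2\<close>, for which the returning multiple of \<open>a (l+1)\<close> is exactly one half and can be absorbed
  on the left.\<close>

lemma interpolation_telescoped:
  fixes a :: "nat \<Rightarrow> real" and Q :: real
  assumes Q: "Q \<ge> 2" and a0: "\<And>l. a l \<ge> 0"
    and step: "\<And>l \<delta>. 0 < \<delta> \<Longrightarrow> \<delta> \<le> 1 \<Longrightarrow> a (Suc l) \<le> Q\<^sup>2 / 4 / \<delta> * a l + \<delta> * a (Suc (Suc l))"
  shows "0 < \<delta> \<Longrightarrow> \<delta> \<le> 1 \<Longrightarrow> l \<ge> 1 \<Longrightarrow> a l \<le> Q ^ (l * (l + 1)) / \<delta> ^ l * a 0 + \<delta> * a (Suc l)"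
proof (induction l arbitrary: \<delta>)
  case (Suc l)
  show ?case
  proof (cases "l = 0")
    case True
    have "a 1 \<le> Q\<^sup>2 / 4 / \<delta> * a 0 + \<delta> * a 2" using step[of \<delta> 0] Suc by (simp add: numeral_2_eq_2)
    also have "Q\<^sup>2 / 4 / \<delta> * a 0 \<le> Q\<^sup>2 / \<delta> * a 0"
      using a0 Suc Q by (intro mult_right_mono divide_right_mono) auto
    finally show ?thesis using True by (simp add: numeral_2_eq_2)
  next
    case False
    have Q1: "Q\<^sup>2 \<ge> 4" using power_mono[of 2 Q 2] Q by simp
    define \<eta> where "\<eta> = \<delta> / 2"
    \<comment> \<open>with \<open>\<eta> = \<delta> / 2\<close> this is \<open>2 * \<eta> / Q\<^sup>2\<close>, so that \<open>Q\<^sup>2 / 4 / \<eta> * \<theta> = 1 / 2\<close>\<close>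
    define \<theta> where "\<theta> = \<delta> / Q\<^sup>2"
    have pos: "\<eta> > 0" "\<eta> \<le> 1" "\<theta> > 0" "\<theta> \<le> 1"
      using Suc.prems Q Q1 by (auto simp: \<eta>_def \<theta>_def field_simps)
    have "a (Suc l) \<le> Q\<^sup>2 / 4 / \<eta> * a l + \<eta> * a (Suc (Suc l))" using step pos by simp
    also have "Q\<^sup>2 / 4 / \<eta> * a l \<le> Q\<^sup>2 / 4 / \<eta> * (Q ^ (l * (l + 1)) / \<theta> ^ l * a 0 + \<theta> * a (Suc l))"
      using Suc.IH[of \<theta>] pos False by (intro mult_left_mono) auto
    also have "\<dots> = Q\<^sup>2 / (2 * \<delta>) * (Q ^ (l * (l + 1)) / \<theta> ^ l) * a 0 + a (Suc l) / 2"
      using Q Suc.prems by (simp add: \<eta>_def \<theta>_def field_simps)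
    finally have "a (Suc l) \<le> Q\<^sup>2 / \<delta> * (Q ^ (l * (l + 1)) / \<theta> ^ l) * a 0 + \<delta> * a (Suc (Suc l))"
      by (simp add: \<eta>_def)
    also have "Q\<^sup>2 / \<delta> * (Q ^ (l * (l + 1)) / \<theta> ^ l) = Q ^ (2 + 2 * l + l * (l + 1)) / \<delta> ^ Suc l"
    proof -
      have "Q ^ (2 + 2 * l + l * (l + 1)) = Q\<^sup>2 * (Q\<^sup>2) ^ l * Q ^ (l * (l + 1))"
        by (simp only: power_add power_mult)
      moreover have "\<theta> ^ l = \<delta> ^ l / (Q\<^sup>2) ^ l" by (simp only: \<theta>_def power_divide)
      ultimately show ?thesis using Suc.prems by simp
    qed
    also have "2 + 2 * l + l * (l + 1) = Suc l * (Suc l + 1)" by (simp add: algebra_simps)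
    finally show ?thesis .
  qed
qed simp

text \<open>All lower terms are bounded at once. For \<open>k + 1\<close>, the induction hypothesis with \<open>\<epsilon> = 1\<close> leaves
  \<open>2 * a k\<close>, which the telescoped inequality with \<open>\<delta> = \<epsilon> / 2\<close> turns into \<open>\<epsilon> * a (k+1)\<close> plus a multiple of
  \<open>a 0\<close>; the factor \<open>2 ^ (k+1)\<close> doubles in each step and absorbs the two multiples of \<open>a 0\<close>.\<close>

lemma interpolation_sum:
  fixes a :: "nat \<Rightarrow> real" and Q :: real
  assumes Q: "Q \<ge> 2" and a0: "\<And>l. a l \<ge> 0"
    and step: "\<And>l \<delta>. 0 < \<delta> \<Longrightarrow> \<delta> \<le> 1 \<Longrightarrow> a (Suc l) \<le> Q\<^sup>2 / 4 / \<delta> * a l + \<delta> * a (Suc (Suc l))"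
  shows "k \<ge> 1 \<Longrightarrow> 0 < \<epsilon> \<Longrightarrow> \<epsilon> \<le> 1 \<Longrightarrow>
    (\<Sum>l<k. a l) \<le> 2 ^ (k + 1) * Q ^ ((k - 1) * k) / \<epsilon> ^ (k - 1) * a 0 + \<epsilon> * a k"
proof (induction k arbitrary: \<epsilon>)
  case (Suc k)
  show ?case
  proof (cases "k = 0")
    case True
    then show ?thesis using a0[of 0] a0[of 1] Suc.prems
      by (simp add: add_nonneg_nonneg mult_nonneg_nonneg add_increasing2)
  next
    case False
    have "(\<Sum>l<Suc k. a l) \<le> 2 ^ (k + 1) * Q ^ ((k - 1) * k) * a 0 + 2 * a k"
      using Suc.IH[of 1] False by simp
    also have "a k \<le> Q ^ (k * (k + 1)) / (\<epsilon> / 2) ^ k * a 0 + \<epsilon> / 2 * a (Suc k)"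
      using Suc.prems False by (intro interpolation_telescoped[of Q a, OF Q a0 step]) auto
    also have "2 ^ (k + 1) * Q ^ ((k - 1) * k) * a 0
        \<le> 2 ^ (k + 1) * (Q ^ (k * (k + 1)) / \<epsilon> ^ k) * a 0"
    proof -
      have "Q ^ ((k - 1) * k) \<le> Q ^ (k * (k + 1))"
        using Q mult_le_mono[of "k - 1" "k + 1" k k] by (intro power_increasing) (auto simp: mult.commute)
      also have "\<dots> \<le> Q ^ (k * (k + 1)) / \<epsilon> ^ k"
        using Q Suc.prems by (simp add: field_simps power_le_one mult_left_le)
      finally show ?thesis using a0 by (intro mult_right_mono mult_left_mono) auto
    qed
    finally have "(\<Sum>l<Suc k. a l) \<le> 2 ^ (k + 1) * (Q ^ (k * (k + 1)) / \<epsilon> ^ k) * a 0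
        + 2 * (Q ^ (k * (k + 1)) / (\<epsilon> / 2) ^ k * a 0 + \<epsilon> / 2 * a (Suc k))" by simp
    also have "\<dots> = 2 ^ (Suc k + 1) * Q ^ (k * (k + 1)) / \<epsilon> ^ k * a 0 + \<epsilon> * a (Suc k)"
      by (simp add: power_divide)
    finally show ?thesis by (simp add: mult.commute)
  qed
qed simp

text \<open>The exponent of \<open>C\<^bsub>1,n\<^esub>\<close> has \<open>l! / (l - 1)! = l\<close> among its summands, and \<open>C\<^bsub>1,n\<^esub> \<ge> 1\<close>.\<close>

lemma sobolev_const_ge:
  assumes "n \<ge> 1" and "l \<ge> 1"
  shows "(18 * sqrt (exp 1) * real n) ^ l \<le> sobolev_const l n"
proof (cases "l = 1")
  case False
  let ?C = "18 * sqrt (exp 1) * real n"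
  have "1 * 1 * 1 \<le> ?C" using assms by (intro mult_mono) auto
  then have C: "1 \<le> ?C" by simp
  have "l = fact l div fact (l - 1)"
    using assms by (cases l) (simp_all add: fact_Suc del: of_nat_Suc)
  also have "\<dots> \<le> (\<Sum>m=1..l. fact l div fact (l - m))"
    using assms by (intro member_le_sum[where f = "\<lambda>m. fact l div fact (l - m)"]) auto
  finally have "?C ^ l \<le> 1 * ?C ^ (\<Sum>m=1..l. fact l div fact (l - m))"
    using power_increasing[OF _ C] by simp
  also have "1 * ?C ^ (\<Sum>m=1..l. fact l div fact (l - m))
      \<le> 2 ^ (\<Sum>m=1..l-1. fact l div fact (l - m)) * ?C ^ (\<Sum>m=1..l. fact l div fact (l - m))"
    using C by (intro mult_right_mono one_le_power zero_le_power) linarith+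
  finally show ?thesis using False by (simp add: sobolev_const_def)
qed (simp add: sobolev_const_def)

section \<open>Displacements towards the origin under the Gaussian measure\<close>

text \<open>The direction away from the origin. Subtracting a multiple of it moves a point towards the
  origin, where the Gaussian density is larger. The value at \<open>0\<close> is \<open>1\<close> rather than \<open>0\<close> so that
  every point really is displaced.\<close>

definition push_sign :: "real \<Rightarrow> real" where
  "push_sign y = (if 0 \<le> y then 1 else - 1)"

lemma measurable_push_sign [measurable]: "push_sign \<in> borel_measurable borel"
  unfolding push_sign_def by measurable

text \<open>On the half-line where \<open>x * t \<ge> 0\<close>, the shift to \<open>y = x - t\<close> costs at most a factor \<open>\<surd>e\<close>:
  \<open>x\<^sup>2 = y\<^sup>2 + 2 * x * t - t\<^sup>2 \<ge> y\<^sup>2 - 1\<close>, so the density at \<open>x\<close> is at most \<open>\<surd>e\<close> times the one at \<open>y\<close>.\<close>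

lemma std_normal_half_shift:
  fixes g :: "real \<Rightarrow> ennreal"
  assumes [measurable]: "g \<in> borel_measurable borel" and t: "\<bar>t\<bar> \<le> 1"
  shows "(\<integral>\<^sup>+x. g (x - t) * indicator {x. 0 \<le> x * t} x \<partial>std_normal_distribution)
    \<le> ennreal (sqrt (exp 1)) * (\<integral>\<^sup>+x. g x \<partial>std_normal_distribution)"
proof -
  have dens: "ennreal (std_normal_density (t + y)) * indicator {x. 0 \<le> x * t} (t + y)
      \<le> ennreal (sqrt (exp 1)) * ennreal (std_normal_density y)" for y
  proof (cases "0 \<le> (t + y) * t")
    case True
    have "t\<^sup>2 \<le> 1" using t by (simp add: abs_square_le_1)
    moreover have "(t + y)\<^sup>2 = y\<^sup>2 + 2 * ((t + y) * t) - t\<^sup>2"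
      by (simp add: power2_eq_square algebra_simps)
    ultimately have "- (t + y)\<^sup>2 / 2 \<le> 1 / 2 + - y\<^sup>2 / 2" using True by linarith
    then have "exp (- (t + y)\<^sup>2 / 2) \<le> exp (1 / 2) * exp (- y\<^sup>2 / 2)"
      by (simp flip: exp_add)
    also have "exp (1 / 2) = sqrt (exp (1::real))"
      by (rule real_sqrt_unique[symmetric]) (simp_all flip: exp_of_nat_mult exp_add add: power2_eq_square)
    finally have "std_normal_density (t + y) \<le> sqrt (exp 1) * std_normal_density y"
      unfolding std_normal_density_def by (simp add: field_simps)
    then show ?thesis using True by (simp add: ennreal_leI flip: ennreal_mult)
  qed simp
  have "(\<integral>\<^sup>+x. g (x - t) * indicator {x. 0 \<le> x * t} x \<partial>std_normal_distribution)
      = (\<integral>\<^sup>+x. ennreal (std_normal_density x) * (g (x - t) * indicator {x. 0 \<le> x * t} x) \<partial>lborel)"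
    by (subst nn_integral_density) auto
  also have "\<dots> = (\<integral>\<^sup>+y. ennreal (std_normal_density (t + y)) * (g y * indicator {x. 0 \<le> x * t} (t + y)) \<partial>lborel)"
    by (subst nn_integral_real_affine[where c = 1 and t = t]) auto
  also have "\<dots> \<le> (\<integral>\<^sup>+y. ennreal (sqrt (exp 1)) * (ennreal (std_normal_density y) * g y) \<partial>lborel)"
  proof (rule nn_integral_mono)
    fix y
    have "ennreal (std_normal_density (t + y)) * (g y * indicator {x. 0 \<le> x * t} (t + y))
        = (ennreal (std_normal_density (t + y)) * indicator {x. 0 \<le> x * t} (t + y)) * g y"
      by (simp only: mult_ac)
    also have "\<dots> \<le> (ennreal (sqrt (exp 1)) * ennreal (std_normal_density y)) * g y"
      by (intro mult_right_mono dens) simp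
    finally show "ennreal (std_normal_density (t + y)) * (g y * indicator {x. 0 \<le> x * t} (t + y))
        \<le> ennreal (sqrt (exp 1)) * (ennreal (std_normal_density y) * g y)"
      by (simp only: mult_ac)
  qed
  also have "\<dots> = ennreal (sqrt (exp 1)) * (\<integral>\<^sup>+x. g x \<partial>std_normal_distribution)"
    by (subst nn_integral_cmult, simp, subst nn_integral_density) auto
  finally show ?thesis .
qed

text \<open>Moving every point by \<open>t\<close> towards the origin (some cross it) distorts the Gaussian measure by a
  bounded factor. For a shift in a fixed direction the density ratio would be unbounded.\<close>

lemma std_normal_push_to_origin:
  fixes g :: "real \<Rightarrow> ennreal"
  assumes [measurable]: "g \<in> borel_measurable borel" and t: "0 \<le> t" "t \<le> 1"
  shows "(\<integral>\<^sup>+x. g (x - t * push_sign x) \<partial>std_normal_distribution)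
    \<le> ennreal (2 * sqrt (exp 1)) * (\<integral>\<^sup>+x. g x \<partial>std_normal_distribution)"
proof -
  have "(\<integral>\<^sup>+x. g (x - t * push_sign x) \<partial>std_normal_distribution)
     \<le> (\<integral>\<^sup>+x. g (x - t) * indicator {x. 0 \<le> x * t} x
          + g (x - (- t)) * indicator {x. 0 \<le> x * (- t)} x \<partial>std_normal_distribution)"
    using t by (intro nn_integral_mono)
      (auto simp: push_sign_def indicator_def mult_le_0_iff zero_le_mult_iff)
  also have "\<dots> = (\<integral>\<^sup>+x. g (x - t) * indicator {x. 0 \<le> x * t} x \<partial>std_normal_distribution)
      + (\<integral>\<^sup>+x. g (x - (- t)) * indicator {x. 0 \<le> x * (- t)} x \<partial>std_normal_distribution)"
    by (rule nn_integral_add) measurable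
  also have "\<dots> \<le> ennreal (sqrt (exp 1)) * (\<integral>\<^sup>+x. g x \<partial>std_normal_distribution)
      + ennreal (sqrt (exp 1)) * (\<integral>\<^sup>+x. g x \<partial>std_normal_distribution)"
    using t by (intro add_mono std_normal_half_shift) auto
  also have "\<dots> = ennreal (2 * sqrt (exp 1)) * (\<integral>\<^sup>+x. g x \<partial>std_normal_distribution)"
    proof -
    have "ennreal (2 * sqrt (exp 1)) = ennreal (sqrt (exp 1)) + ennreal (sqrt (exp 1))"
      by (simp flip: ennreal_plus)
    then show ?thesis by (simp only: distrib_right)
  qed
  finally show ?thesis .
qed

interpretation std_normal: prob_space std_normal_distribution
  by (rule prob_space_normal_density) simp

abbreviation gauss_product :: "'i set \<Rightarrow> ('i \<Rightarrow> real) measure" where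
  "gauss_product I \<equiv> PiM I (\<lambda>_. std_normal_distribution)"

lemma prob_space_gauss_product: "prob_space (gauss_product I)"
  by (rule prob_space_PiM) (rule std_normal.prob_space_axioms)

lemma measurable_push_coordinate:
  assumes "c \<in> I"
  shows "(\<lambda>p. (snd p)(c := snd p c - fst p * push_sign (snd p c)))
    \<in> measurable (borel \<Otimes>\<^sub>M gauss_product I) (gauss_product I)"
proof (rule measurable_PiM_single')
  show "(\<lambda>p. ((snd p)(c := snd p c - fst p * push_sign (snd p c))) i)
      \<in> measurable (borel \<Otimes>\<^sub>M gauss_product I) std_normal_distribution" if i: "i \<in> I" for i
  proof -
    have coord: "(\<lambda>p::real \<times> _. snd p j) \<in> borel_measurable (borel \<Otimes>\<^sub>M gauss_product I)" if "j \<in> I" for j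
      using measurable_compose[OF measurable_snd measurable_component_singleton[OF that, of "\<lambda>_. std_normal_distribution"]]
      by simp
    note [measurable] = coord[OF i] coord[OF assms]
    show ?thesis by (cases "i = c") (simp_all, measurable)
  qed
  show "(\<lambda>p. (snd p)(c := snd p c - fst p * push_sign (snd p c)))
      \<in> space (borel \<Otimes>\<^sub>M gauss_product I) \<rightarrow> (\<Pi>\<^sub>E i\<in>I. space std_normal_distribution)"
    using assms by (auto simp: space_pair_measure space_PiM PiE_iff extensional_def)
qed

lemma gauss_product_push_to_origin:
  fixes g :: "('i \<Rightarrow> real) \<Rightarrow> ennreal"
  assumes I: "finite I" "c \<in> I" and g [measurable]: "g \<in> borel_measurable (gauss_product I)"
    and t: "0 \<le> t" "t \<le> 1"
  shows "(\<integral>\<^sup>+x. g (x(c := x c - t * push_sign (x c))) \<partial>gauss_product I)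
    \<le> ennreal (2 * sqrt (exp 1)) * (\<integral>\<^sup>+x. g x \<partial>gauss_product I)"
proof -
  interpret product_sigma_finite "\<lambda>_::'i. std_normal_distribution"
    by unfold_locales
  define J where "J = I - {c}"
  have J: "I = insert c J" "finite J" "c \<notin> J" using I by (auto simp: J_def)
  let ?T = "\<lambda>x::'i \<Rightarrow> real. x(c := x c - t * push_sign (x c))"
  have "(\<lambda>x. (t, x)) \<in> measurable (gauss_product I) (borel \<Otimes>\<^sub>M gauss_product I)" by simp
  from measurable_compose[OF measurable_compose[OF this measurable_push_coordinate[OF I(2)]] g]
  have gT: "(\<lambda>x. g (?T x)) \<in> borel_measurable (gauss_product I)" by simp
  have "(\<integral>\<^sup>+x. g (?T x) \<partial>gauss_product I)
     = (\<integral>\<^sup>+x. (\<integral>\<^sup>+y. g (?T (x(c := y))) \<partial>std_normal_distribution) \<partial>gauss_product J)"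
    unfolding J(1) using J gT by (intro product_nn_integral_insert) simp_all
  also have "\<dots> = (\<integral>\<^sup>+x. (\<integral>\<^sup>+y. g (x(c := y - t * push_sign y)) \<partial>std_normal_distribution) \<partial>gauss_product J)"
    by simp
  also have "\<dots> \<le> (\<integral>\<^sup>+x. ennreal (2 * sqrt (exp 1)) * (\<integral>\<^sup>+y. g (x(c := y)) \<partial>std_normal_distribution) \<partial>gauss_product J)"
  proof (rule nn_integral_mono)
    fix x assume x: "x \<in> space (gauss_product J)"
    have "(\<lambda>y. g (x(c := y))) \<in> borel_measurable std_normal_distribution"
      by (rule measurable_compose[OF measurable_component_update[OF x] g[unfolded J(1)]]) (rule J)
    then have "(\<lambda>y. g (x(c := y))) \<in> borel_measurable borel" by simp
    from std_normal_push_to_origin[OF this t]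
    show "(\<integral>\<^sup>+y. g (x(c := y - t * push_sign y)) \<partial>std_normal_distribution)
       \<le> ennreal (2 * sqrt (exp 1)) * (\<integral>\<^sup>+y. g (x(c := y)) \<partial>std_normal_distribution)" by simp
  qed
  also have "\<dots> = ennreal (2 * sqrt (exp 1)) * (\<integral>\<^sup>+x. (\<integral>\<^sup>+y. g (x(c := y)) \<partial>std_normal_distribution) \<partial>gauss_product J)"
  proof (rule nn_integral_cmult)
    have "(\<lambda>p. (fst p)(c := snd p)) \<in> measurable (gauss_product J \<Otimes>\<^sub>M std_normal_distribution) (gauss_product I)"
      unfolding J(1) by (rule measurable_add_dim[unfolded split_beta'])
    from measurable_compose[OF this g]
    have "(\<lambda>(x, y). g (x(c := y))) \<in> borel_measurable (gauss_product J \<Otimes>\<^sub>M std_normal_distribution)"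
      by (simp add: split_beta')
    then show "(\<lambda>x. \<integral>\<^sup>+y. g (x(c := y)) \<partial>std_normal_distribution) \<in> borel_measurable (gauss_product J)"
      by (rule sigma_finite_measure.borel_measurable_nn_integral[OF std_normal.sigma_finite_measure_axioms])
  qed
  also have "(\<integral>\<^sup>+x. (\<integral>\<^sup>+y. g (x(c := y)) \<partial>std_normal_distribution) \<partial>gauss_product J) = (\<integral>\<^sup>+x. g x \<partial>gauss_product I)"
    unfolding J(1) using J g by (intro product_nn_integral_insert[symmetric]) simp_all
  finally show ?thesis .
qed

lemma Lq_bounded_push:
  assumes I: "finite I" "c \<in> I" and t: "0 \<le> t" "t \<le> 1" and q: "q \<ge> 1"
    and f: "Lq_bounded (gauss_product I) q f s"
  shows "Lq_bounded (gauss_product I) q (\<lambda>x. f (x(c := x c - t * push_sign (x c)))) (2 * sqrt (exp 1) * s)"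
proof -
  let ?T = "\<lambda>x::'a \<Rightarrow> real. x(c := x c - t * push_sign (x c))"
  let ?K = "2 * sqrt (exp (1::real))"
  have fm [measurable]: "f \<in> borel_measurable (gauss_product I)" and s: "s \<ge> 0"
    using f by (auto simp: Lq_bounded_def)
  have Tm: "?T \<in> measurable (gauss_product I) (gauss_product I)"
  proof -
    have "(\<lambda>x. (t, x)) \<in> measurable (gauss_product I) (borel \<Otimes>\<^sub>M gauss_product I)" by simp
    from measurable_compose[OF this measurable_push_coordinate[OF I(2)]] show ?thesis by simp
  qed
  have "(\<integral>\<^sup>+x. ennreal (f (?T x) powr q) \<partial>gauss_product I)
      \<le> ennreal ?K * (\<integral>\<^sup>+x. ennreal (f x powr q) \<partial>gauss_product I)"
    using I t by (intro gauss_product_push_to_origin[where g = "\<lambda>x. ennreal (f x powr q)"]) auto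
  also have "\<dots> \<le> ennreal ?K * ennreal (s powr q)"
    using f by (intro mult_left_mono) (auto simp: Lq_bounded_def)
  also have "\<dots> = ennreal (?K powr 1 * s powr q)" by (simp flip: ennreal_mult)
  also have "\<dots> \<le> ennreal (?K powr q * s powr q)"
  proof (intro ennreal_leI mult_right_mono powr_mono)
    have "2 * 1 \<le> ?K" by (intro mult_left_mono) auto
    then show "1 \<le> ?K" by linarith
  qed (use q in auto)
  also have "\<dots> = ennreal ((?K * s) powr q)" using s by (simp add: powr_mult)
  finally show ?thesis
    using f s measurable_compose[OF Tm fm] measurable_space[OF Tm] by (auto simp: Lq_bounded_def)
qed

text \<open>Jensen's inequality moves the power inside the average, and Fubini's theorem reduces the claim
  to each single value of the parameter.\<close>

lemma Lq_bounded_average: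
  assumes U: "prob_space U" and P: "sigma_finite_measure P" and q: "q \<ge> 1" and s: "s \<ge> 0"
    and f [measurable]: "(\<lambda>p. f (fst p) (snd p)) \<in> borel_measurable (U \<Otimes>\<^sub>M P)"
    and b: "\<And>r. r \<in> space U \<Longrightarrow> Lq_bounded P q (f r) s"
    and int: "\<And>x. x \<in> space P \<Longrightarrow> integrable U (\<lambda>r. f r x)"
  shows "Lq_bounded P q (\<lambda>x. \<integral>r. f r x \<partial>U) s"
proof -
  interpret U: prob_space U by fact
  interpret P: sigma_finite_measure P by fact
  interpret pair_sigma_finite U P by unfold_locales
  have f0: "0 \<le> f r x" if "r \<in> space U" "x \<in> space P" for r x
    using b[OF that(1)] that by (auto simp: Lq_bounded_def)
  have swap: "(\<lambda>(x, r). f r x) \<in> borel_measurable (P \<Otimes>\<^sub>M U)"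
    using measurable_compose[OF measurable_pair_swap' f] by (simp add: split_beta')
  have "(\<integral>\<^sup>+x. ennreal ((\<integral>r. f r x \<partial>U) powr q) \<partial>P) \<le> (\<integral>\<^sup>+x. (\<integral>\<^sup>+r. ennreal (f r x powr q) \<partial>U) \<partial>P)"
    using U q f0 int by (intro nn_integral_mono powr_jensen) auto
  also have "\<dots> = (\<integral>\<^sup>+r. (\<integral>\<^sup>+x. ennreal (f r x powr q) \<partial>P) \<partial>U)"
    using Fubini[of "\<lambda>p. ennreal (f (fst p) (snd p) powr q)"] by simp
  also have "\<dots> \<le> (\<integral>\<^sup>+r. ennreal (s powr q) \<partial>U)"
    using b by (intro nn_integral_mono) (auto simp: Lq_bounded_def)
  also have "\<dots> = ennreal (s powr q)" by (simp add: U.emeasure_space_1)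
  finally show ?thesis
    using s f0 U.borel_measurable_lebesgue_integral[OF swap]
    by (auto simp: Lq_bounded_def intro!: integral_nonneg_AE)
qed

section \<open>Interpolation of Gaussian \<open>L\<^sup>q\<close> norms of derivatives\<close>

text \<open>The Hilbert-Schmidt norm is the Euclidean norm of the family of values on lists of basis
  vectors; the Cauchy-Schwarz and triangle inequalities below come from there.\<close>

lemma tensor_norm_eq_L2_set: "tensor_norm k T = L2_set (\<lambda>bs. norm (T bs)) (basis_lists k)"
  by (simp add: tensor_norm_def tensor_inner_def L2_set_def power2_norm_eq_inner)

lemma tensor_norm_nonneg [simp]: "0 \<le> tensor_norm k T"
  by (simp add: tensor_norm_eq_L2_set L2_set_nonneg)

lemma tensor_norm_power2: "(tensor_norm k T)\<^sup>2 = tensor_inner k T T"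
  unfolding tensor_norm_def
  by (rule real_sqrt_pow2) (simp add: tensor_inner_def sum_nonneg)

lemma tensor_cauchy_schwarz: "\<bar>tensor_inner k S T\<bar> \<le> tensor_norm k S * tensor_norm k T"
proof -
  have "\<bar>tensor_inner k S T\<bar> \<le> (\<Sum>bs\<in>basis_lists k. \<bar>norm (S bs)\<bar> * \<bar>norm (T bs)\<bar>)"
    unfolding tensor_inner_def
    by (rule order_trans[OF sum_abs]) (auto intro!: sum_mono Cauchy_Schwarz_ineq2)
  also have "\<dots> \<le> tensor_norm k S * tensor_norm k T"
    unfolding tensor_norm_eq_L2_set by (rule L2_set_mult_ineq)
  finally show ?thesis .
qed

lemma tensor_norm_Suc_power2:
  fixes T :: "'h::euclidean_space list \<Rightarrow> 'v::real_inner"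
  shows "(tensor_norm (Suc k) T)\<^sup>2 = (\<Sum>b\<in>Basis. (tensor_norm k (\<lambda>bs. T (b # bs)))\<^sup>2)"
  unfolding tensor_norm_power2 by (simp add: tensor_inner_def sum_basis_lists_Suc)

lemma tensor_norm_Suc_le_sum:
  fixes T :: "'h::euclidean_space list \<Rightarrow> 'v::real_inner"
  shows "tensor_norm (Suc k) T \<le> (\<Sum>b\<in>Basis. tensor_norm k (\<lambda>bs. T (b # bs)))"
proof -
  have "tensor_norm (Suc k) T = L2_set (\<lambda>b. tensor_norm k (\<lambda>bs. T (b # bs))) Basis"
    unfolding L2_set_def tensor_norm_Suc_power2[symmetric] by simp
  also have "\<dots> \<le> (\<Sum>b\<in>Basis. tensor_norm k (\<lambda>bs. T (b # bs)))"
    by (rule L2_set_le_sum) simp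
  finally show ?thesis .
qed

lemma tensor_norm_slice_le:
  fixes T :: "'h::euclidean_space list \<Rightarrow> 'v::real_inner"
  assumes "c \<in> Basis"
  shows "tensor_norm k (\<lambda>bs. T (c # bs)) \<le> tensor_norm (Suc k) T"
proof -
  have "(tensor_norm k (\<lambda>bs. T (c # bs)))\<^sup>2 \<le> (tensor_norm (Suc k) T)\<^sup>2"
    unfolding tensor_norm_Suc_power2 using assms by (intro member_le_sum) auto
  then show ?thesis by (rule power2_le_imp_le) simp
qed

abbreviation unit_interval :: "real measure" where
  "unit_interval \<equiv> restrict_space lborel {0..1}"

lemma prob_space_unit_interval: "prob_space unit_interval"
  by (rule prob_space_restrict_space) auto

lemma integrable_unit_interval_continuous:
  fixes f :: "real \<Rightarrow> real"
  assumes "continuous_on UNIV f"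
  shows "integrable unit_interval f"
proof -
  have "integrable lborel (\<lambda>x. indicator {0..1} x *\<^sub>R f x)"
    by (rule borel_integrable_compact) (auto intro: continuous_on_subset[OF assms])
  then show ?thesis by (simp add: integrable_restrict_space)
qed

lemma unit_interval_FTC:
  fixes f F :: "real \<Rightarrow> real"
  assumes "\<And>r. (F has_real_derivative f r) (at r)" and "continuous_on UNIV f"
  shows "(\<integral>r. f r \<partial>unit_interval) = F 1 - F 0"
proof -
  have "(\<integral>r. f r * indicator {0..1} r \<partial>lborel) = F 1 - F 0"
    using assms by (intro integral_FTC_Icc_real) (auto simp: continuous_on_eq_continuous_at)
  then show ?thesis by (simp add: integral_restrict_space mult.commute)
qed

text \<open>The analytic part of the argument sees a smooth function on \<open>\<real>\<^sup>n\<close> only through its sequence of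
  derivative tensors: \<open>D l x\<close> is the \<open>l\<close>-th derivative at \<open>x\<close>, evaluated on lists of directions, and
  the newest direction of differentiation is the head of the list. So differentiating the tensor
  \<open>D l\<close> twice in the direction \<open>c\<close> prepends \<open>c, c\<close> to its list of arguments.\<close>

locale gaussian_derivative_tower =
  fixes D :: "nat \<Rightarrow> ('h::euclidean_space \<Rightarrow> real) \<Rightarrow> 'h list \<Rightarrow> 'v::real_inner" and q :: real
  assumes q: "q \<ge> 1"
    and deriv: "c \<in> Basis \<Longrightarrow> ((\<lambda>t. D l (x(c := t)) bs) has_vector_derivative D (Suc l) (x(c := t)) (c # bs)) (at t)"
    and meas [measurable]: "(\<lambda>x. tensor_norm l (D l x)) \<in> borel_measurable (gauss_product Basis)"
    and int: "integrable (gauss_product Basis) (\<lambda>x. tensor_norm l (D l x) powr q)"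
begin

lemma deriv_along_line:
  assumes "c \<in> Basis"
  shows "((\<lambda>r. D l (x(c := x c - r * d)) bs) has_vector_derivative
    - d *\<^sub>R D (Suc l) (x(c := x c - r * d)) (c # bs)) (at r)"
proof -
  have "((\<lambda>r. x c - r * d) has_vector_derivative - d) (at r)"
    by (auto intro!: derivative_eq_intros)
  from vector_diff_chain_at[OF this deriv[OF assms]] show ?thesis by (simp add: o_def)
qed

lemma continuous_along_line:
  assumes "c \<in> Basis"
  shows "continuous_on UNIV (\<lambda>r. D l (x(c := x c - r * d)) bs)"
  using has_vector_derivative_continuous[OF deriv_along_line[OF assms]]
  by (auto intro: continuous_at_imp_continuous_on)

lemma tensor_norm_continuous_along_line:
  assumes "c \<in> Basis"
  shows "continuous_on UNIV (\<lambda>r. tensor_norm l (D l (x(c := x c - r * d))))"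
  unfolding tensor_norm_eq_L2_set L2_set_def
  using assms by (intro continuous_intros continuous_along_line)

text \<open>Taylor's formula in the direction \<open>c\<close>, applied to the \<open>l\<close>-th derivative with step \<open>- d\<close> and solved for
  the first-order term. To obtain norms of tensors from scalar calculus, everything is paired with
  the first-order term \<open>S\<close> itself; the result is divided by its norm \<open>\<rho>\<close> in the end.\<close>

lemma taylor_slice:
  assumes c: "c \<in> Basis" and d: "d \<noteq> 0"
  shows "tensor_norm l (\<lambda>bs. D (Suc l) x (c # bs))
    \<le> (tensor_norm l (D l x) + tensor_norm l (D l (x(c := x c - d)))) / \<bar>d\<bar>
      + \<bar>d\<bar> * (\<integral>r. tensor_norm (Suc (Suc l)) (D (Suc (Suc l)) (x(c := x c - r * d))) \<partial>unit_interval)"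
    (is "?\<rho> \<le> (?v + ?w) / _ + _ * ?I")
proof -
  define S where "S = (\<lambda>bs. D (Suc l) x (c # bs))"
  define \<rho> where "\<rho> = tensor_norm l S"
  define y where "y = (\<lambda>r. x(c := x c - r * d))"
  let ?u = "\<lambda>r. tensor_norm (Suc (Suc l)) (D (Suc (Suc l)) (y r))"
  define G where "G = (\<lambda>r. tensor_inner l S (D l (y r)))"
  define G1 where "G1 = (\<lambda>r. tensor_inner l S (\<lambda>bs. D (Suc l) (y r) (c # bs)))"
  define G2 where "G2 = (\<lambda>r. tensor_inner l S (\<lambda>bs. D (Suc (Suc l)) (y r) (c # c # bs)))"
  have u_cont: "continuous_on UNIV ?u"
    unfolding y_def by (rule tensor_norm_continuous_along_line[OF c])
  have u_int: "integrable unit_interval ?u"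
    by (rule integrable_unit_interval_continuous[OF u_cont])
  have I0: "0 \<le> (\<integral>r. ?u r \<partial>unit_interval)" by (intro integral_nonneg_AE) simp
  have y0: "y 0 = x" by (simp add: y_def)
  have dG: "(G has_real_derivative - d * G1 r) (at r)" for r
    unfolding has_real_derivative_iff_has_vector_derivative G_def G1_def tensor_inner_def y_def
    by (auto intro!: derivative_eq_intros deriv_along_line[OF c] bounded_linear.has_vector_derivative[OF bounded_linear_inner_right]
        simp: sum_distrib_left)
  have dG1: "(G1 has_real_derivative - d * G2 r) (at r)" for r
    unfolding has_real_derivative_iff_has_vector_derivative G1_def G2_def tensor_inner_def y_def
    by (auto intro!: derivative_eq_intros deriv_along_line[OF c] bounded_linear.has_vector_derivative[OF bounded_linear_inner_right]
        simp: sum_distrib_left)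
  \<comment> \<open>\<open>H\<close> is an antiderivative of the integrand in the integral remainder of Taylor's formula\<close>
  define H where "H = (\<lambda>r. (1 - r) * (- d * G1 r) + G r)"
  have dH: "(H has_real_derivative (1 - r) * (d\<^sup>2 * G2 r)) (at r)" for r
    unfolding H_def
    by (auto intro!: derivative_eq_intros dG dG1 simp: power2_eq_square algebra_simps)
  have G2_cont: "continuous_on UNIV G2"
    unfolding G2_def tensor_inner_def y_def by (intro continuous_intros continuous_along_line[OF c])
  have rem_cont: "continuous_on UNIV (\<lambda>r. (1 - r) * (d\<^sup>2 * G2 r))"
    by (intro continuous_intros G2_cont)
  have "(\<integral>r. (1 - r) * (d\<^sup>2 * G2 r) \<partial>unit_interval) = H 1 - H 0"
    by (rule unit_interval_FTC[OF dH rem_cont])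
  also have "\<dots> = G 1 - G 0 + d * \<rho>\<^sup>2"
    by (simp add: H_def G1_def y0 \<rho>_def tensor_norm_power2 flip: S_def)
  finally have taylor: "d * \<rho>\<^sup>2 = (\<integral>r. (1 - r) * (d\<^sup>2 * G2 r) \<partial>unit_interval) + G 0 - G 1"
    by simp
  have G2_le: "\<bar>G2 r\<bar> \<le> \<rho> * ?u r" for r
  proof -
    have "\<bar>G2 r\<bar> \<le> \<rho> * tensor_norm l (\<lambda>bs. D (Suc (Suc l)) (y r) (c # c # bs))"
      unfolding G2_def \<rho>_def by (rule tensor_cauchy_schwarz)
    also have "\<dots> \<le> \<rho> * ?u r"
      using tensor_norm_slice_le[OF c, of l "\<lambda>bs. D (Suc (Suc l)) (y r) (c # bs)"]
        tensor_norm_slice_le[OF c, of "Suc l" "D (Suc (Suc l)) (y r)"]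
      by (intro mult_left_mono) (auto simp: \<rho>_def)
    finally show ?thesis .
  qed
  have "\<bar>\<integral>r. (1 - r) * (d\<^sup>2 * G2 r) \<partial>unit_interval\<bar> \<le> (\<integral>r. d\<^sup>2 * \<rho> * ?u r \<partial>unit_interval)"
  proof (rule order_trans[OF integral_abs_bound integral_mono])
    show "integrable unit_interval (\<lambda>r. \<bar>(1 - r) * (d\<^sup>2 * G2 r)\<bar>)"
      by (rule integrable_abs, rule integrable_unit_interval_continuous[OF rem_cont])
    show "integrable unit_interval (\<lambda>r. d\<^sup>2 * \<rho> * ?u r)" using u_int by simp
    fix r assume "r \<in> space unit_interval"
    then have r: "0 \<le> r" "r \<le> 1" by (auto simp: space_restrict_space)
    have "\<bar>1 - r\<bar> * (d\<^sup>2 * \<bar>G2 r\<bar>) \<le> 1 * (d\<^sup>2 * (\<rho> * ?u r))"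
      using r G2_le[of r] by (intro mult_mono) auto
    then show "\<bar>(1 - r) * (d\<^sup>2 * G2 r)\<bar> \<le> d\<^sup>2 * \<rho> * ?u r"
      by (simp add: abs_mult mult_ac)
  qed
  also have "\<dots> = d\<^sup>2 * \<rho> * (\<integral>r. ?u r \<partial>unit_interval)" by simp
  finally have rem: "\<bar>\<integral>r. (1 - r) * (d\<^sup>2 * G2 r) \<partial>unit_interval\<bar> \<le> d\<^sup>2 * \<rho> * (\<integral>r. ?u r \<partial>unit_interval)" .
  have "\<bar>G r\<bar> \<le> \<rho> * tensor_norm l (D l (y r))" for r
    unfolding G_def \<rho>_def by (rule tensor_cauchy_schwarz)
  from this[of 0] this[of 1] taylor rem
  have "\<bar>d * \<rho>\<^sup>2\<bar> \<le> \<rho> * ?v + \<rho> * tensor_norm l (D l (y 1)) + d\<^sup>2 * \<rho> * (\<integral>r. ?u r \<partial>unit_interval)"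
    unfolding y0 by linarith
  then have "\<rho> * (\<bar>d\<bar> * \<rho>) \<le> \<rho> * (?v + ?w + d\<^sup>2 * ?I)"
    by (simp add: abs_mult power2_eq_square algebra_simps y_def)
  moreover have "\<rho> = 0 \<or> 0 < \<rho>"
    using tensor_norm_nonneg[of l S] unfolding \<rho>_def[symmetric] by linarith
  ultimately have "\<rho> = 0 \<or> \<bar>d\<bar> * \<rho> \<le> ?v + ?w + d\<^sup>2 * ?I"
    using mult_le_cancel_left_pos[of \<rho>] by blast
  then have "\<bar>d\<bar> * \<rho> \<le> ?v + ?w + d\<^sup>2 * ?I"
  proof
    have "0 \<le> ?v + ?w + d\<^sup>2 * ?I"
      using I0 unfolding y_def by (intro add_nonneg_nonneg mult_nonneg_nonneg tensor_norm_nonneg) simp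
    then show "\<bar>d\<bar> * \<rho> \<le> ?v + ?w + d\<^sup>2 * ?I" if "\<rho> = 0" unfolding that by simp
  qed
  also have "\<dots> = \<bar>d\<bar> * ((?v + ?w) / \<bar>d\<bar> + \<bar>d\<bar> * ?I)"
  proof -
    have "\<bar>d\<bar> * (\<bar>d\<bar> * ?I) = d\<^sup>2 * ?I" by (simp only: mult.assoc[symmetric] abs_mult_self_eq power2_eq_square)
    then show ?thesis using d by (simp only: distrib_left) simp
  qed
  finally show ?thesis
    using d by (simp add: \<rho>_def S_def)
qed

definition seminorm :: "nat \<Rightarrow> real" where
  "seminorm l = Lq_norm (gauss_product Basis) q (\<lambda>x. x) (\<lambda>x. tensor_norm l (D l x))"

lemma seminorm_nonneg: "0 \<le> seminorm l"
  by (simp add: seminorm_def Lq_norm_def)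

lemma tensor_norm_Lq_bounded:
  "Lq_bounded (gauss_product Basis) q (\<lambda>x. tensor_norm l (D l x)) (seminorm l)"
  unfolding seminorm_def using q int by (intro Lq_bounded_Lq_norm) auto

text \<open>The \<open>L\<^sup>q\<close> norm of \<open>taylor_slice\<close> with step length \<open>L\<close> directed towards the origin. Each displaced
  term costs the factor \<open>2\<surd>e\<close>, also after averaging over the segment, by Jensen's inequality and
  Fubini's theorem. Bounding the norm of a tensor by the sum of the norms of its \<open>n\<close> slices yields
  the factor \<open>n\<close>.\<close>

lemma one_step_interpolation_length:
  assumes L: "0 < L" "L \<le> 1"
  defines "\<kappa> \<equiv> 2 * sqrt (exp (1::real))"
  shows "seminorm (Suc l) \<le> real DIM('h) *
    ((seminorm l + \<kappa> * seminorm l) / L + L * (\<kappa> * seminorm (Suc (Suc l))))"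
proof -
  let ?P = "gauss_product (Basis :: 'h set)"
  let ?T = "\<lambda>c r x. x(c := x c - (r * L) * push_sign (x c))"
  let ?u = "\<lambda>l x. tensor_norm l (D l x)"
  interpret P: prob_space ?P by (rule prob_space_gauss_product)
  have slice: "Lq_bounded ?P q
      (\<lambda>x. 1 / L * (?u l x + ?u l (?T c 1 x)) + L * (\<integral>r. ?u (Suc (Suc l)) (?T c r x) \<partial>unit_interval))
      (1 / L * (seminorm l + \<kappa> * seminorm l) + L * (\<kappa> * seminorm (Suc (Suc l))))"
    if c: "c \<in> Basis" for c
  proof (intro Lq_bounded_add Lq_bounded_cmult tensor_norm_Lq_bounded q)
    show "Lq_bounded ?P q (\<lambda>x. ?u l (?T c 1 x)) (\<kappa> * seminorm l)"
      unfolding \<kappa>_def using L c q tensor_norm_Lq_bounded by (intro Lq_bounded_push) auto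
    show "Lq_bounded ?P q (\<lambda>x. \<integral>r. ?u (Suc (Suc l)) (?T c r x) \<partial>unit_interval) (\<kappa> * seminorm (Suc (Suc l)))"
    proof (rule Lq_bounded_average[OF prob_space_unit_interval P.sigma_finite_measure_axioms q])
      show "0 \<le> \<kappa> * seminorm (Suc (Suc l))" by (simp add: \<kappa>_def seminorm_nonneg)
      have "(\<lambda>p. (fst p * L, snd p)) \<in> measurable (unit_interval \<Otimes>\<^sub>M ?P) (borel \<Otimes>\<^sub>M ?P)"
      proof (rule measurable_Pair)
        have "(\<lambda>r::real. r * L) \<in> measurable unit_interval borel"
          by (rule measurable_restrict_space1) simp
        then show "(\<lambda>p. fst p * L) \<in> measurable (unit_interval \<Otimes>\<^sub>M ?P) borel"
          by (rule measurable_compose[OF measurable_fst])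
      qed simp
      from measurable_compose[OF measurable_compose[OF this measurable_push_coordinate[OF c]] meas]
      show "(\<lambda>p. ?u (Suc (Suc l)) (?T c (fst p) (snd p))) \<in> borel_measurable (unit_interval \<Otimes>\<^sub>M ?P)"
        by simp
      show "Lq_bounded ?P q (\<lambda>x. ?u (Suc (Suc l)) (?T c r x)) (\<kappa> * seminorm (Suc (Suc l)))"
        if "r \<in> space unit_interval" for r
        unfolding \<kappa>_def using that L c q tensor_norm_Lq_bounded
        by (intro Lq_bounded_push) (auto simp: space_restrict_space mult_le_one)
      show "integrable unit_interval (\<lambda>r. ?u (Suc (Suc l)) (?T c r x))" for x
        using integrable_unit_interval_continuous[OF tensor_norm_continuous_along_line[OF c,
            of "Suc (Suc l)" x "L * push_sign (x c)"]]
        by (simp add: mult.assoc)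
    qed
  qed (use L in auto)
  have "Lq_bounded ?P q (?u (Suc l)) (\<Sum>c\<in>(Basis::'h set).
      1 / L * (seminorm l + \<kappa> * seminorm l) + L * (\<kappa> * seminorm (Suc (Suc l))))"
  proof (rule Lq_bounded_mono[OF Lq_bounded_sum[OF finite_Basis slice q] q])
    fix x
    have "?u (Suc l) x \<le> (\<Sum>c\<in>Basis. tensor_norm l (\<lambda>bs. D (Suc l) x (c # bs)))"
      by (rule tensor_norm_Suc_le_sum)
    also have "\<dots> \<le> (\<Sum>c\<in>Basis. 1 / L * (?u l x + ?u l (?T c 1 x))
        + L * (\<integral>r. ?u (Suc (Suc l)) (?T c r x) \<partial>unit_interval))"
    proof (rule sum_mono)
      fix c :: 'h assume c: "c \<in> Basis"
      have "\<bar>L * push_sign (x c)\<bar> = L" "L * push_sign (x c) \<noteq> 0"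
        using L by (auto simp: push_sign_def)
      with taylor_slice[OF c this(2), of l x]
      show "tensor_norm l (\<lambda>bs. D (Suc l) x (c # bs)) \<le> 1 / L * (?u l x + ?u l (?T c 1 x))
        + L * (\<integral>r. ?u (Suc (Suc l)) (?T c r x) \<partial>unit_interval)"
        by (simp add: mult.assoc)
    qed
    finally show "?u (Suc l) x \<le> (\<Sum>c\<in>Basis. 1 / L * (?u l x + ?u l (?T c 1 x))
        + L * (\<integral>r. ?u (Suc (Suc l)) (?T c r x) \<partial>unit_interval))" .
  qed auto
  from Lq_norm_le_of_bounded[OF this q] show ?thesis
    by (simp add: seminorm_def)
qed

text \<open>The step length is chosen such that the coefficient of the highest norm becomes \<open>\<delta>\<close>. The
  remaining coefficient is at most \<open>2 * (2\<surd>e n)\<^sup>2 / \<delta>\<close>, which is well below the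
  \<open>81 * e * n\<^sup>2 / \<delta>\<close> that is claimed.\<close>

lemma one_step_interpolation:
  assumes \<delta>: "0 < \<delta>" "\<delta> \<le> 1"
  shows "seminorm (Suc l) \<le> (18 * sqrt (exp 1) * real DIM('h))\<^sup>2 / 4 / \<delta> * seminorm l
    + \<delta> * seminorm (Suc (Suc l))"
proof -
  define \<kappa> where "\<kappa> = 2 * sqrt (exp (1::real))"
  define n where "n = real DIM('h)"
  have n: "n \<ge> 1" unfolding n_def using DIM_positive[where 'a='h] by (simp add: Suc_leI)
  have "2 * 1 \<le> \<kappa>" unfolding \<kappa>_def by (intro mult_left_mono) auto
  then have \<kappa>: "\<kappa> \<ge> 1" by linarith
  define L where "L = \<delta> / (\<kappa> * n)"
  have "1 * 1 \<le> \<kappa> * n" using \<kappa> n by (intro mult_mono) auto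
  then have kn: "\<kappa> * n \<ge> 1" by simp
  have L: "0 < L" "L \<le> 1" using kn \<delta> by (auto simp: L_def field_simps)
  have "seminorm (Suc l) \<le> n * ((seminorm l + \<kappa> * seminorm l) / L + L * (\<kappa> * seminorm (Suc (Suc l))))"
    using one_step_interpolation_length[OF L, of l] by (simp add: \<kappa>_def n_def)
  also have "\<dots> = n * (1 + \<kappa>) / L * seminorm l + L * (\<kappa> * n) * seminorm (Suc (Suc l))"
    using L by (simp add: field_simps)
  also have "L * (\<kappa> * n) = \<delta>" using \<kappa> n by (simp add: L_def)
  also have "n * (1 + \<kappa>) / L * seminorm l \<le> (18 * sqrt (exp 1) * n)\<^sup>2 / 4 / \<delta> * seminorm l"
  proof (rule mult_right_mono[OF _ seminorm_nonneg])
    have "n * (1 + \<kappa>) / L = n\<^sup>2 * (\<kappa> * (1 + \<kappa>)) / \<delta>" by (simp add: L_def power2_eq_square)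
    also have "\<dots> \<le> n\<^sup>2 * (\<kappa> * (\<kappa> + \<kappa>)) / \<delta>"
      using \<delta> \<kappa> by (intro divide_right_mono mult_left_mono) auto
    also have "n\<^sup>2 * (\<kappa> * (\<kappa> + \<kappa>)) = 2 * (\<kappa> * n)\<^sup>2" by (simp add: power2_eq_square)
    also have "\<dots> / \<delta> \<le> 81 / 4 * (\<kappa> * n)\<^sup>2 / \<delta>"
      using \<delta> by (intro divide_right_mono mult_right_mono) auto
    also have "81 / 4 * (\<kappa> * n)\<^sup>2 / \<delta> = (9 * \<kappa> * n)\<^sup>2 / 4 / \<delta>"
      by (simp add: power2_eq_square)
    finally show "n * (1 + \<kappa>) / L \<le> (18 * sqrt (exp 1) * n)\<^sup>2 / 4 / \<delta>"
      by (simp add: \<kappa>_def)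
  qed
  finally show ?thesis by (simp add: n_def)
qed

lemma seminorm_interpolation:
  assumes "k \<ge> 1" "0 < \<epsilon>" "\<epsilon> \<le> 1"
  shows "(\<Sum>l<k. seminorm l) \<le> 2 ^ (k + 1) * (18 * sqrt (exp 1) * real DIM('h)) ^ ((k - 1) * k) / \<epsilon> ^ (k - 1)
      * seminorm 0 + \<epsilon> * seminorm k"
proof (rule interpolation_sum[of _ seminorm, OF _ seminorm_nonneg one_step_interpolation assms])
  have "18 * 1 * 1 \<le> 18 * sqrt (exp 1) * real DIM('h)"
    by (intro mult_mono) (auto simp: Suc_leI)
  then show "2 \<le> 18 * sqrt (exp 1) * real DIM('h)" by linarith
qed

end

section \<open>Independence from characteristic functions\<close>

lemma (in prob_space) char_distr:
  assumes "X \<in> borel_measurable M"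
  shows "char (distr M borel X) t = expectation (\<lambda>\<omega>. iexp (t * X \<omega>))"
  unfolding char_def using assms by (subst integral_distr) auto

lemma (in prob_space) integrable_bounded_complex:
  fixes Y :: "'a \<Rightarrow> complex"
  assumes "Y \<in> borel_measurable M" "\<And>\<omega>. \<omega> \<in> space M \<Longrightarrow> norm (Y \<omega>) \<le> 1"
  shows "integrable M Y"
  using assms by (intro integrable_const_bound[where B = 1]) auto

text \<open>The shifted and normalized variable \<open>Z\<close> is a probability density; by the hypothesis
  \<open>X\<close> has the same characteristic function under \<open>Z\<close> as under the original measure, hence the same
  law by Levy's uniqueness theorem. The shift by \<open>2\<close> makes \<open>Z\<close> positive.\<close>

lemma (in prob_space) indicator_factorization_real:
  fixes Y :: "'a \<Rightarrow> real"
  assumes [measurable]: "Y \<in> borel_measurable M" "X \<in> borel_measurable M" "A \<in> sets borel"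
    and Y1: "\<And>\<omega>. \<omega> \<in> space M \<Longrightarrow> \<bar>Y \<omega>\<bar> \<le> 1"
    and eq: "\<And>t. expectation (\<lambda>\<omega>. complex_of_real (Y \<omega>) * iexp (t * X \<omega>))
      = complex_of_real (expectation Y) * expectation (\<lambda>\<omega>. iexp (t * X \<omega>))"
  shows "expectation (\<lambda>\<omega>. Y \<omega> * indicator A (X \<omega>)) = expectation Y * expectation (\<lambda>\<omega>. indicator A (X \<omega>))"
proof -
  have Yint: "integrable M Y" using Y1 by (intro integrable_const_bound[where B = 1]) auto
  have indint: "integrable M (\<lambda>\<omega>. indicator A (X \<omega>) :: real)"
    by (intro integrable_const_bound[where B = 1]) auto
  have Yindint: "integrable M (\<lambda>\<omega>. Y \<omega> * indicator A (X \<omega>))"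
    using Y1 by (intro integrable_const_bound[where B = 1]) (auto simp: indicator_def)
  have "\<bar>expectation Y\<bar> \<le> expectation (\<lambda>\<omega>. \<bar>Y \<omega>\<bar>)" by (rule integral_abs_bound)
  also have "\<dots> \<le> expectation (\<lambda>\<omega>. 1)" using Yint Y1 by (intro integral_mono) auto
  finally have "\<bar>expectation Y\<bar> \<le> 1" by (simp add: prob_space)
  then have pos: "2 + expectation Y > 0" by linarith
  define Z where "Z = (\<lambda>\<omega>. (2 + Y \<omega>) / (2 + expectation Y))"
  have [measurable]: "Z \<in> borel_measurable M" unfolding Z_def by measurable
  have Z0: "0 \<le> Z \<omega>" if "\<omega> \<in> space M" for \<omega>
  proof -
    have "0 \<le> 2 + Y \<omega>" using Y1[OF that] by linarith
    then show ?thesis using pos by (simp add: Z_def)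
  qed
  have Zint: "integrable M Z" unfolding Z_def using Yint by simp
  have EZ: "expectation Z = 1"
    unfolding Z_def using Yint pos by (simp add: prob_space)
  let ?N = "density M Z"
  have N: "prob_space ?N"
  proof
    have "emeasure ?N (space ?N) = (\<integral>\<^sup>+\<omega>. ennreal (Z \<omega>) \<partial>M)"
      by (simp add: emeasure_density cong: nn_integral_cong)
    also have "\<dots> = 1" using Zint Z0 EZ by (subst nn_integral_eq_integral) auto
    finally show "emeasure ?N (space ?N) = 1" .
  qed
  interpret N: prob_space ?N by (rule N)
  have "char (distr ?N borel X) = char (distr M borel X)"
  proof
    fix t
    have iint: "integrable M (\<lambda>\<omega>. iexp (t * X \<omega>))"
      by (rule integrable_bounded_complex) auto
    have Yiint: "integrable M (\<lambda>\<omega>. complex_of_real (Y \<omega>) * iexp (t * X \<omega>))"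
      by (rule integrable_bounded_complex) (auto simp: norm_mult Y1)
    have "char (distr ?N borel X) t = N.expectation (\<lambda>\<omega>. iexp (t * X \<omega>))"
      by (rule N.char_distr) simp
    also have "\<dots> = expectation (\<lambda>\<omega>. Z \<omega> *\<^sub>R iexp (t * X \<omega>))"
      using Z0 by (subst integral_density) auto
    also have "\<dots> = expectation (\<lambda>\<omega>. (2 * iexp (t * X \<omega>) + complex_of_real (Y \<omega>) * iexp (t * X \<omega>))
        / complex_of_real (2 + expectation Y))"
      by (simp add: Z_def scaleR_conv_of_real algebra_simps)
    also have "\<dots> = (2 * expectation (\<lambda>\<omega>. iexp (t * X \<omega>))
        + expectation (\<lambda>\<omega>. complex_of_real (Y \<omega>) * iexp (t * X \<omega>))) / complex_of_real (2 + expectation Y)"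
      using iint Yiint by simp
    also have "\<dots> = (complex_of_real (2 + expectation Y) * expectation (\<lambda>\<omega>. iexp (t * X \<omega>)))
         / complex_of_real (2 + expectation Y)"
      unfolding eq by (simp add: algebra_simps)
    also have "\<dots> = expectation (\<lambda>\<omega>. iexp (t * X \<omega>))"
      using pos by (simp del: of_real_add)
    also have "\<dots> = char (distr M borel X) t" by (rule char_distr[symmetric]) simp
    finally show "char (distr ?N borel X) t = char (distr M borel X) t" .
  qed
  then have same: "distr ?N borel X = distr M borel X"
    by (intro Levy_uniqueness N.real_distribution_distr real_distribution_distr) auto
  have "expectation (\<lambda>\<omega>. indicator A (X \<omega>) :: real) = (\<integral>x. indicator A x \<partial>distr M borel X)"
    by (subst integral_distr) auto
  also have "\<dots> = N.expectation (\<lambda>\<omega>. indicator A (X \<omega>))"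
    unfolding same[symmetric] by (subst integral_distr) auto
  also have "\<dots> = expectation (\<lambda>\<omega>. Z \<omega> *\<^sub>R indicator A (X \<omega>))"
    using Z0 by (subst integral_density) auto
  also have "\<dots> = expectation (\<lambda>\<omega>. (2 * indicator A (X \<omega>) + Y \<omega> * indicator A (X \<omega>)) / (2 + expectation Y))"
    by (simp add: Z_def algebra_simps)
  also have "\<dots> = (2 * expectation (\<lambda>\<omega>. indicator A (X \<omega>)) + expectation (\<lambda>\<omega>. Y \<omega> * indicator A (X \<omega>)))
      / (2 + expectation Y)"
    using indint Yindint by simp
  finally show ?thesis using pos by (simp add: field_simps)
qed

text \<open>Conjugating the hypothesis at \<open>- t\<close> shows that it also holds for the conjugate of \<open>Y\<close>, and hence
  for the real and the imaginary part.\<close>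

lemma (in prob_space) indicator_factorization:
  fixes Y :: "'a \<Rightarrow> complex"
  assumes [measurable]: "Y \<in> borel_measurable M" "X \<in> borel_measurable M" "A \<in> sets borel"
    and Y1: "\<And>\<omega>. \<omega> \<in> space M \<Longrightarrow> norm (Y \<omega>) \<le> 1"
    and eq: "\<And>t. expectation (\<lambda>\<omega>. Y \<omega> * iexp (t * X \<omega>)) = expectation Y * expectation (\<lambda>\<omega>. iexp (t * X \<omega>))"
  shows "expectation (\<lambda>\<omega>. Y \<omega> * complex_of_real (indicator A (X \<omega>)))
    = expectation Y * complex_of_real (expectation (\<lambda>\<omega>. indicator A (X \<omega>)))"
proof -
  have [measurable]: "(\<lambda>\<omega>. cnj (Y \<omega>)) \<in> borel_measurable M"
    by (simp add: borel_measurable_complex_iff)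
  have Yint: "integrable M Y" by (rule integrable_bounded_complex) (auto simp: Y1)
  have Yiint: "integrable M (\<lambda>\<omega>. Y \<omega> * iexp (t * X \<omega>))" for t
    by (rule integrable_bounded_complex) (auto simp: norm_mult Y1)
  have cYiint: "integrable M (\<lambda>\<omega>. cnj (Y \<omega>) * iexp (t * X \<omega>))" for t
    by (rule integrable_bounded_complex) (auto simp: norm_mult Y1)
  have ceq: "expectation (\<lambda>\<omega>. cnj (Y \<omega>) * iexp (t * X \<omega>))
      = cnj (expectation Y) * expectation (\<lambda>\<omega>. iexp (t * X \<omega>))" for t
  proof -
    have cnj_iexp: "cnj (iexp (- t * X \<omega>)) = iexp (t * X \<omega>)" for \<omega>
      by (simp add: exp_cnj)
    have "expectation (\<lambda>\<omega>. cnj (Y \<omega> * iexp (- t * X \<omega>))) = cnj (expectation Y * expectation (\<lambda>\<omega>. iexp (- t * X \<omega>)))"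
      unfolding eq[of "- t", symmetric] by (rule Bochner_Integration.integral_cnj)
    then show ?thesis
      by (simp only: complex_cnj_mult cnj_iexp flip: Bochner_Integration.integral_cnj)
  qed
  have nRe: "\<bar>Re (Y \<omega>)\<bar> \<le> 1" "\<bar>Im (Y \<omega>)\<bar> \<le> 1" if "\<omega> \<in> space M" for \<omega>
    using Y1[OF that] abs_Re_le_cmod[of "Y \<omega>"] abs_Im_le_cmod[of "Y \<omega>"] by linarith+
  have R: "complex_of_real (Re z) = (z + cnj z) / 2" "complex_of_real (Im z) = (z - cnj z) / (2 * \<i>)" for z
    by (simp_all add: complex_eq_iff)
  have ERe: "expectation (\<lambda>\<omega>. Re (Y \<omega>)) = Re (expectation Y)" "expectation (\<lambda>\<omega>. Im (Y \<omega>)) = Im (expectation Y)"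
    using Yint by simp_all
  have re: "expectation (\<lambda>\<omega>. Re (Y \<omega>) * indicator A (X \<omega>)) = Re (expectation Y) * expectation (\<lambda>\<omega>. indicator A (X \<omega>))"
    unfolding ERe[symmetric]
  proof (rule indicator_factorization_real)
    fix t
    have "expectation (\<lambda>\<omega>. complex_of_real (Re (Y \<omega>)) * iexp (t * X \<omega>))
        = expectation (\<lambda>\<omega>. (Y \<omega> * iexp (t * X \<omega>) + cnj (Y \<omega>) * iexp (t * X \<omega>)) / 2)"
      by (simp add: R algebra_simps add_divide_distrib)
    also have "\<dots> = (expectation (\<lambda>\<omega>. Y \<omega> * iexp (t * X \<omega>))
        + expectation (\<lambda>\<omega>. cnj (Y \<omega>) * iexp (t * X \<omega>))) / 2"
      using Yiint[of t] cYiint[of t] by simp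
    also have "\<dots> = complex_of_real (Re (expectation Y)) * expectation (\<lambda>\<omega>. iexp (t * X \<omega>))"
      unfolding eq ceq R by (simp add: algebra_simps add_divide_distrib)
    finally show "expectation (\<lambda>\<omega>. complex_of_real (Re (Y \<omega>)) * iexp (t * X \<omega>))
      = complex_of_real (expectation (\<lambda>\<omega>. Re (Y \<omega>))) * expectation (\<lambda>\<omega>. iexp (t * X \<omega>))"
      by (simp add: ERe)
  qed (auto simp: nRe)
  have im: "expectation (\<lambda>\<omega>. Im (Y \<omega>) * indicator A (X \<omega>)) = Im (expectation Y) * expectation (\<lambda>\<omega>. indicator A (X \<omega>))"
    unfolding ERe[symmetric]
  proof (rule indicator_factorization_real)
    fix t
    have "expectation (\<lambda>\<omega>. complex_of_real (Im (Y \<omega>)) * iexp (t * X \<omega>))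
        = expectation (\<lambda>\<omega>. (Y \<omega> * iexp (t * X \<omega>) - cnj (Y \<omega>) * iexp (t * X \<omega>)) / (2 * \<i>))"
      by (simp add: R algebra_simps diff_divide_distrib)
    also have "\<dots> = (expectation (\<lambda>\<omega>. Y \<omega> * iexp (t * X \<omega>))
        - expectation (\<lambda>\<omega>. cnj (Y \<omega>) * iexp (t * X \<omega>))) / (2 * \<i>)"
      using Yiint[of t] cYiint[of t] by simp
    also have "\<dots> = complex_of_real (Im (expectation Y)) * expectation (\<lambda>\<omega>. iexp (t * X \<omega>))"
      unfolding eq ceq R by (simp add: algebra_simps diff_divide_distrib)
    finally show "expectation (\<lambda>\<omega>. complex_of_real (Im (Y \<omega>)) * iexp (t * X \<omega>))
      = complex_of_real (expectation (\<lambda>\<omega>. Im (Y \<omega>))) * expectation (\<lambda>\<omega>. iexp (t * X \<omega>))"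
      by (simp add: ERe)
  qed (auto simp: nRe)
  have int: "integrable M (\<lambda>\<omega>. Y \<omega> * complex_of_real (indicator A (X \<omega>)))"
    by (rule integrable_bounded_complex) (auto simp: norm_mult Y1 indicator_def)
  show ?thesis
    using re im integral_Re[OF int] integral_Im[OF int] by (simp add: complex_eq_iff)
qed

text \<open>Independence is reduced to the uniqueness theorem for distributions on the real line: the
  exponentials are replaced by indicators one coordinate at a time, with the indicators and exponentials of all other coordinates
  collected in the factor \<open>Y\<close>.\<close>

lemma (in prob_space) joint_distribution_of_char:
  fixes X :: "'i \<Rightarrow> 'a \<Rightarrow> real"
  assumes I: "finite I" and X [measurable]: "\<And>i. i \<in> I \<Longrightarrow> X i \<in> borel_measurable M"
    and fac: "\<And>\<xi>. expectation (\<lambda>\<omega>. iexp (\<Sum>i\<in>I. \<xi> i * X i \<omega>)) = (\<Prod>i\<in>I. char (distr M borel (X i)) (\<xi> i))"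
  shows "distr M (PiM I (\<lambda>_. borel)) (\<lambda>\<omega>. \<lambda>i\<in>I. X i \<omega>) = PiM I (\<lambda>i. distr M borel (X i))"
proof -
  let ?\<phi> = "\<lambda>i. char (distr M borel (X i))"
  have partial: "expectation (\<lambda>\<omega>. (\<Prod>i\<in>S. complex_of_real (indicator (A i) (X i \<omega>))) * iexp (\<Sum>i\<in>I - S. \<xi> i * X i \<omega>))
      = (\<Prod>i\<in>S. complex_of_real (expectation (\<lambda>\<omega>. indicator (A i) (X i \<omega>)))) * (\<Prod>i\<in>I - S. ?\<phi> i (\<xi> i))"
    if "S \<subseteq> I" "\<And>i. i \<in> S \<Longrightarrow> A i \<in> sets borel" for S A \<xi>
    using finite_subset[OF that(1) I] that
  proof (induction S arbitrary: \<xi>)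
    case empty
    then show ?case using fac[of \<xi>] by simp
  next
    case (insert c S)
    then have c: "c \<in> I" "c \<notin> S" "S \<subseteq> I" and A [measurable]: "\<And>i. i \<in> S \<Longrightarrow> A i \<in> sets borel" "A c \<in> sets borel"
      by auto
    have S [measurable]: "\<And>i. i \<in> S \<Longrightarrow> X i \<in> borel_measurable M" "X c \<in> borel_measurable M"
      "\<And>i. i \<in> I - insert c S \<Longrightarrow> X i \<in> borel_measurable M" using c X by auto
    let ?R = "I - insert c S"
    have IS: "I - S = insert c ?R" "finite ?R" "c \<notin> ?R" using c I by auto
    define Y where "Y = (\<lambda>\<omega>. (\<Prod>i\<in>S. complex_of_real (indicator (A i) (X i \<omega>))) * iexp (\<Sum>i\<in>?R. \<xi> i * X i \<omega>))"
    have Ym: "Y \<in> borel_measurable M" unfolding Y_def by measurable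
    have Y1: "norm (Y \<omega>) \<le> 1" for \<omega>
      unfolding Y_def by (auto simp: norm_mult prod_norm[symmetric] intro!: prod_le_1)
    let ?E = "\<Prod>i\<in>S. complex_of_real (expectation (\<lambda>\<omega>. indicator (A i) (X i \<omega>)))"
    have Yt: "expectation (\<lambda>\<omega>. Y \<omega> * iexp (t * X c \<omega>)) = ?E * (\<Prod>i\<in>?R. ?\<phi> i (\<xi> i)) * ?\<phi> c t" for t
    proof -
      have "(\<Sum>i\<in>I - S. (\<xi>(c := t)) i * X i \<omega>) = t * X c \<omega> + (\<Sum>i\<in>?R. \<xi> i * X i \<omega>)" for \<omega>
        unfolding IS(1) using IS(2,3) by (auto intro!: sum.cong)
      moreover have "(\<Prod>i\<in>I - S. ?\<phi> i ((\<xi>(c := t)) i)) = ?\<phi> c t * (\<Prod>i\<in>?R. ?\<phi> i (\<xi> i))"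
        unfolding IS(1) using IS(2,3) by (auto intro!: prod.cong)
      ultimately show ?thesis
        using insert.IH[of "\<xi>(c := t)"] c A
        by (simp add: Y_def exp_add distrib_left mult_ac)
    qed
    have "?\<phi> c 0 = 1" using S by (simp add: char_distr prob_space)
    then have EY: "expectation Y = ?E * (\<Prod>i\<in>?R. ?\<phi> i (\<xi> i))" using Yt[of 0] by simp
    have "expectation (\<lambda>\<omega>. Y \<omega> * complex_of_real (indicator (A c) (X c \<omega>)))
      = expectation Y * complex_of_real (expectation (\<lambda>\<omega>. indicator (A c) (X c \<omega>)))"
      by (rule indicator_factorization[OF Ym S(2) A(2) Y1]) (simp only: Yt EY char_distr[OF S(2)])
    then show ?case unfolding EY using insert.hyps by (simp add: Y_def mult_ac)
  qed
  interpret product_sigma_finite "\<lambda>i. if i \<in> I then distr M borel (X i) else return borel 0"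
  proof (rule product_sigma_finite.intro)
    fix i show "sigma_finite_measure (if i \<in> I then distr M borel (X i) else return borel 0)"
      by (auto intro!: prob_space_imp_sigma_finite prob_space_distr prob_space_return)
  qed
  have "distr M (PiM I (\<lambda>_. borel)) (\<lambda>\<omega>. \<lambda>i\<in>I. X i \<omega>)
      = PiM I (\<lambda>i. if i \<in> I then distr M borel (X i) else return borel 0)"
  proof (rule PiM_eqI[OF I])
    show "sets (distr M (PiM I (\<lambda>_. borel)) (\<lambda>\<omega>. \<lambda>i\<in>I. X i \<omega>))
      = sets (PiM I (\<lambda>i. if i \<in> I then distr M borel (X i) else return borel 0))"
      by (auto intro!: sets_PiM_cong)
    fix A :: "'i \<Rightarrow> real set"
    assume "\<And>i. i \<in> I \<Longrightarrow> A i \<in> sets (if i \<in> I then distr M borel (X i) else return borel 0)"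
    then have A [measurable]: "\<And>i. i \<in> I \<Longrightarrow> A i \<in> sets borel" by force
    have Xm: "(\<lambda>\<omega>. \<lambda>i\<in>I. X i \<omega>) \<in> measurable M (PiM I (\<lambda>_. borel))" by measurable
    have ind: "indicator (PiE I A) (\<lambda>i\<in>I. X i \<omega>) = (\<Prod>i\<in>I. indicator (A i) (X i \<omega>) :: real)" for \<omega>
      using I by (auto simp: indicator_def prod_zero_iff PiE_iff)
    have E: "expectation (\<lambda>\<omega>. indicator (B i) (X i \<omega>)) = measure (distr M borel (X i)) (B i)"
      if "i \<in> I" "B i \<in> sets borel" for i B
    proof -
      interpret D: prob_space "distr M borel (X i)" using that X by (intro prob_space_distr) auto
      have "expectation (\<lambda>\<omega>. indicator (B i) (X i \<omega>) :: real) = (\<integral>x. indicator (B i) x \<partial>distr M borel (X i))"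
        using that X by (subst integral_distr) auto
      then show ?thesis using that by simp
    qed
    interpret D: prob_space "distr M (PiM I (\<lambda>_. borel)) (\<lambda>\<omega>. \<lambda>i\<in>I. X i \<omega>)" by (rule prob_space_distr[OF Xm])
    have "complex_of_real (expectation (\<lambda>\<omega>. \<Prod>i\<in>I. indicator (A i) (X i \<omega>)))
        = (\<Prod>i\<in>I. complex_of_real (expectation (\<lambda>\<omega>. indicator (A i) (X i \<omega>))))"
      using partial[of I A] A by (simp flip: integral_complex_of_real)
    then have "expectation (\<lambda>\<omega>. \<Prod>i\<in>I. indicator (A i) (X i \<omega>) :: real) = (\<Prod>i\<in>I. expectation (\<lambda>\<omega>. indicator (A i) (X i \<omega>)))"
      by (simp only: of_real_prod[symmetric] of_real_eq_iff)
    also have "\<dots> = (\<Prod>i\<in>I. measure (distr M borel (X i)) (A i))" using A by (intro prod.cong E) auto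
    finally have *: "expectation (\<lambda>\<omega>. indicator (PiE I A) (\<lambda>i\<in>I. X i \<omega>)) = (\<Prod>i\<in>I. measure (distr M borel (X i)) (A i))"
      by (simp add: ind)
    have box: "PiE I A \<in> sets (PiM I (\<lambda>_. borel))" using I A by (intro sets_PiM_I_finite) auto
    have "expectation (\<lambda>\<omega>. indicator (PiE I A) (\<lambda>i\<in>I. X i \<omega>) :: real)
        = (\<integral>x. indicator (PiE I A) x \<partial>distr M (PiM I (\<lambda>_. borel)) (\<lambda>\<omega>. \<lambda>i\<in>I. X i \<omega>))"
      using box by (subst integral_distr[OF Xm]) auto
    also have "\<dots> = measure (distr M (PiM I (\<lambda>_. borel)) (\<lambda>\<omega>. \<lambda>i\<in>I. X i \<omega>)) (PiE I A)" using box by simp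
    finally have "measure (distr M (PiM I (\<lambda>_. borel)) (\<lambda>\<omega>. \<lambda>i\<in>I. X i \<omega>)) (PiE I A)
        = (\<Prod>i\<in>I. measure (distr M borel (X i)) (A i))" using * by simp
    moreover have "emeasure (if i \<in> I then distr M borel (X i) else return borel 0) (A i)
        = ennreal (measure (distr M borel (X i)) (A i))" if "i \<in> I" for i
      using that prob_space_distr[of "X i" borel] X
      by (auto simp: finite_measure.emeasure_eq_measure prob_space_def)
    ultimately show "emeasure (distr M (PiM I (\<lambda>_. borel)) (\<lambda>\<omega>. \<lambda>i\<in>I. X i \<omega>)) (PiE I A)
      = (\<Prod>i\<in>I. emeasure (if i \<in> I then distr M borel (X i) else return borel 0) (A i))"
      by (simp add: D.emeasure_eq_measure prod_ennreal)
  qed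
  also have "\<dots> = PiM I (\<lambda>i. distr M borel (X i))" by (rule PiM_cong) auto
  finally show ?thesis .
qed

section \<open>The law of a finite-dimensional isonormal process\<close>

lemma (in prob_space) centered_gaussian_cases:
  assumes "centered_gaussian M X"
  obtains (degenerate) "AE \<omega> in M. X \<omega> = 0" "X \<in> borel_measurable M"
    | (normal) \<sigma> where "\<sigma> > 0" "distributed M lborel X (normal_density 0 \<sigma>)" "X \<in> borel_measurable M"
  using assms by (auto simp: centered_gaussian_def)

lemma (in prob_space) centered_gaussian_moments:
  assumes "centered_gaussian M X"
  shows "integrable M (\<lambda>\<omega>. \<bar>X \<omega>\<bar> ^ k)"
  using assms
proof (cases rule: centered_gaussian_cases)
  case degenerate
  have "integrable M (\<lambda>\<omega>. (0::real) ^ k)" by simp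
  moreover have "AE \<omega> in M. (0::real) ^ k = \<bar>X \<omega>\<bar> ^ k" using degenerate(1) by eventually_elim simp
  ultimately show ?thesis using degenerate(2) by (subst integrable_cong_AE[where g = "\<lambda>_. 0 ^ k"]) auto
next
  case (normal \<sigma>)
  then show ?thesis
    using integrable_normal_moment_abs[OF normal(1), of 0 k]
      distributed_integrable[OF normal(2), of "\<lambda>x. \<bar>x\<bar> ^ k"] by simp
qed

lemma (in prob_space) normal_second_moment:
  assumes "distributed M lborel X (normal_density 0 \<sigma>)" and "\<sigma> > 0"
  shows "expectation (\<lambda>\<omega>. (X \<omega>)\<^sup>2) = \<sigma>\<^sup>2"
  using distributed_integral[OF assms(1), of "\<lambda>x. x\<^sup>2"] integral_normal_moment_even[OF assms(2), of 0 1]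
    assms(2) by (simp add: fact_2)

lemma (in prob_space) centered_gaussian_char:
  assumes "centered_gaussian M X"
  shows "expectation (\<lambda>\<omega>. iexp (X \<omega>)) = complex_of_real (exp (- expectation (\<lambda>\<omega>. (X \<omega>)\<^sup>2) / 2))"
  using assms
proof (cases rule: centered_gaussian_cases)
  case degenerate
  have "expectation (\<lambda>\<omega>. iexp (X \<omega>)) = expectation (\<lambda>\<omega>. 1)"
    using degenerate by (intro integral_cong_AE) auto
  moreover have "expectation (\<lambda>\<omega>. (X \<omega>)\<^sup>2) = expectation (\<lambda>\<omega>. 0)"
    using degenerate by (intro integral_cong_AE) auto
  ultimately show ?thesis by (simp add: prob_space)
next
  case (normal \<sigma>)
  note [measurable] = normal(3)
  have "distributed M lborel (\<lambda>\<omega>. X \<omega> / \<sigma>) std_normal_density"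
    using normal normal_standard_normal_convert[of \<sigma> X 0] by simp
  then have d: "distr M lborel (\<lambda>\<omega>. X \<omega> / \<sigma>) = std_normal_distribution"
    by (rule distributed_distr_eq_density)
  have "distr M borel (\<lambda>\<omega>. X \<omega> / \<sigma>) = std_normal_distribution"
    unfolding d[symmetric] by (rule distr_cong) auto
  then have "char std_normal_distribution \<sigma> = expectation (\<lambda>\<omega>. iexp (\<sigma> * (X \<omega> / \<sigma>)))"
    using char_distr[of "\<lambda>\<omega>. X \<omega> / \<sigma>" \<sigma>] by simp
  then show ?thesis
    using normal(1) by (simp add: char_std_normal_distribution normal_second_moment[OF normal(2,1)])
qed

context isonormal_gaussian
begin

lemma gaussian_W: "centered_gaussian M (W h)"
  using gaussian_family[of "{h}" "\<lambda>_. 1"] by simp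

lemma measurable_W [measurable]: "W h \<in> borel_measurable M"
  using gaussian_W[of h] by (simp add: centered_gaussian_def)

lemma integrable_W_mult: "integrable M (\<lambda>\<omega>. W h \<omega> * W g \<omega>)"
proof (rule Bochner_Integration.integrable_bound)
  show "integrable M (\<lambda>\<omega>. \<bar>W h \<omega>\<bar> ^ 2 + \<bar>W g \<omega>\<bar> ^ 2)"
    by (intro Bochner_Integration.integrable_add centered_gaussian_moments gaussian_W)
  have "\<bar>a * b\<bar> \<le> a\<^sup>2 + b\<^sup>2" for a b :: real
  proof -
    have "0 \<le> (\<bar>a\<bar> - \<bar>b\<bar>)\<^sup>2 + (a\<^sup>2 + b\<^sup>2)" by simp
    then show ?thesis by (simp add: power2_diff abs_mult)
  qed
  then show "AE \<omega> in M. norm (W h \<omega> * W g \<omega>) \<le> norm (\<bar>W h \<omega>\<bar> ^ 2 + \<bar>W g \<omega>\<bar> ^ 2)" by simp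
qed measurable

lemma second_moment_combination:
  assumes "finite A"
  shows "expectation (\<lambda>\<omega>. (\<Sum>h\<in>A. c h * W h \<omega>)\<^sup>2) = (norm (\<Sum>h\<in>A. c h *\<^sub>R h))\<^sup>2"
proof -
  have "expectation (\<lambda>\<omega>. (\<Sum>h\<in>A. c h * W h \<omega>)\<^sup>2)
      = expectation (\<lambda>\<omega>. \<Sum>h\<in>A. \<Sum>g\<in>A. (c h * c g) * (W h \<omega> * W g \<omega>))"
    by (simp add: power2_eq_square sum_product mult_ac)
  also have "\<dots> = (\<Sum>h\<in>A. \<Sum>g\<in>A. (c h * c g) * (h \<bullet> g))"
    by (simp add: integrable_W_mult covariance)
  also have "\<dots> = (norm (\<Sum>h\<in>A. c h *\<^sub>R h))\<^sup>2"
    by (simp add: power2_norm_eq_inner inner_sum_left inner_sum_right sum_distrib_left mult_ac inner_commute)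
  finally show ?thesis .
qed

end

locale finite_dim_isonormal = isonormal_gaussian M W
  for M :: "'a measure" and W :: "'h::euclidean_space \<Rightarrow> 'a \<Rightarrow> real"
begin

lemma W_basis_distribution:
  assumes "b \<in> Basis"
  shows "distr M borel (W b) = std_normal_distribution"
proof -
  have "expectation (\<lambda>\<omega>. (W b \<omega>)\<^sup>2) = 1"
    using covariance[of b b] assms by (simp add: power2_eq_square)
  with gaussian_W[of b] have d: "distributed M lborel (W b) std_normal_density"
  proof (cases rule: centered_gaussian_cases)
    case degenerate
    have "expectation (\<lambda>\<omega>. (W b \<omega>)\<^sup>2) = expectation (\<lambda>\<omega>. 0)"
      using degenerate by (intro integral_cong_AE) auto
    with \<open>expectation (\<lambda>\<omega>. (W b \<omega>)\<^sup>2) = 1\<close> show ?thesis by simp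
  next
    case (normal \<sigma>)
    with \<open>expectation (\<lambda>\<omega>. (W b \<omega>)\<^sup>2) = 1\<close> have "\<sigma>\<^sup>2 = 1"
      by (simp add: normal_second_moment)
    then have "\<sigma> = 1" using normal(1) by (simp add: power2_eq_1_iff)
    with normal show ?thesis by simp
  qed
  have "distr M borel (W b) = distr M lborel (W b)" by (rule distr_cong) auto
  also have "\<dots> = std_normal_distribution" by (rule distributed_distr_eq_density[OF d])
  finally show ?thesis .
qed

text \<open>The process in coordinates. Restricting the domain to the basis puts the values into the
  carrier of the product space.\<close>

definition coords :: "'a \<Rightarrow> 'h \<Rightarrow> real" where
  "coords \<omega> = (\<lambda>b\<in>Basis. W b \<omega>)"

text \<open>The joint characteristic function at \<open>\<xi>\<close> is that of one centered Gaussian variable with variance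
  \<open>\<bar>\<xi>\<bar>\<^sup>2\<close>, and therefore a product.\<close>

lemma coords_distribution: "distr M (gauss_product Basis) coords = gauss_product Basis"
proof -
  have "distr M (PiM Basis (\<lambda>_. borel)) (\<lambda>\<omega>. \<lambda>b\<in>Basis. W b \<omega>) = PiM Basis (\<lambda>b. distr M borel (W b))"
  proof (rule joint_distribution_of_char[OF finite_Basis measurable_W])
    fix \<xi> :: "'h \<Rightarrow> real"
    let ?Z = "\<lambda>\<omega>. \<Sum>b\<in>Basis. \<xi> b * W b \<omega>"
    have "(norm (\<Sum>b\<in>Basis. \<xi> b *\<^sub>R b))\<^sup>2 = (\<Sum>b\<in>Basis. (\<xi> b)\<^sup>2)"
      unfolding power2_norm_eq_inner
      by (subst euclidean_inner) (simp add: power2_eq_square inner_sum_left_Basis)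
    then have "expectation (\<lambda>\<omega>. iexp (?Z \<omega>)) = complex_of_real (exp (- (\<Sum>b\<in>Basis. (\<xi> b)\<^sup>2) / 2))"
      using centered_gaussian_char[OF gaussian_family[OF finite_Basis, of \<xi>]]
        second_moment_combination[OF finite_Basis, of \<xi>] by simp
    also have "\<dots> = (\<Prod>b\<in>Basis. complex_of_real (exp (- (\<xi> b)\<^sup>2 / 2)))"
      by (simp add: sum_divide_distrib exp_sum flip: of_real_prod sum_negf)
    also have "\<dots> = (\<Prod>b\<in>Basis. char (distr M borel (W b)) (\<xi> b))"
      by (intro prod.cong) (simp_all add: W_basis_distribution char_std_normal_distribution)
    finally show "expectation (\<lambda>\<omega>. iexp (?Z \<omega>)) = (\<Prod>b\<in>Basis. char (distr M borel (W b)) (\<xi> b))" .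
  qed
  also have "PiM Basis (\<lambda>b. distr M borel (W b)) = gauss_product Basis"
    by (rule PiM_cong) (simp_all add: W_basis_distribution)
  also have "distr M (PiM Basis (\<lambda>_. borel)) (\<lambda>\<omega>. \<lambda>b\<in>Basis. W b \<omega>) = distr M (gauss_product Basis) coords"
    by (rule distr_cong) (auto simp: coords_def intro!: sets_PiM_cong)
  finally show ?thesis .
qed

lemma measurable_coords [measurable]: "coords \<in> measurable M (gauss_product Basis)"
proof -
  have "coords \<in> measurable M (PiM Basis (\<lambda>_. borel))" unfolding coords_def by measurable
  also have "measurable M (PiM Basis (\<lambda>_. borel)) = measurable M (gauss_product (Basis :: 'h set))"
    by (rule measurable_cong_sets) (auto intro!: sets_PiM_cong)
  finally show ?thesis .
qed

text \<open>Linearity of the process holds only almost surely: the difference of both sides has vanishing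
  second moment.\<close>

lemma W_expansion: "AE \<omega> in M. W h \<omega> = (\<Sum>b\<in>Basis. (h \<bullet> b) * coords \<omega> b)"
proof -
  define Z where "Z = (\<lambda>\<omega>. W h \<omega> - (\<Sum>b\<in>Basis. (h \<bullet> b) * W b \<omega>))"
  have [measurable]: "Z \<in> borel_measurable M" unfolding Z_def by measurable
  have sq: "(Z \<omega>)\<^sup>2 = W h \<omega> * W h \<omega> - 2 * (\<Sum>b\<in>Basis. (h \<bullet> b) * (W h \<omega> * W b \<omega>))
      + (\<Sum>b\<in>Basis. \<Sum>c\<in>Basis. ((h \<bullet> b) * (h \<bullet> c)) * (W b \<omega> * W c \<omega>))" for \<omega>
  proof -
    have "(\<Sum>b\<in>Basis. (h \<bullet> b) * (W h \<omega> * W b \<omega>)) = W h \<omega> * (\<Sum>b\<in>Basis. (h \<bullet> b) * W b \<omega>)"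
      by (simp add: sum_distrib_left mult_ac)
    moreover have "(\<Sum>b\<in>Basis. \<Sum>c\<in>Basis. ((h \<bullet> b) * (h \<bullet> c)) * (W b \<omega> * W c \<omega>))
        = (\<Sum>b\<in>Basis. (h \<bullet> b) * W b \<omega>) * (\<Sum>b\<in>Basis. (h \<bullet> b) * W b \<omega>)"
      by (simp add: sum_product mult_ac)
    ultimately show ?thesis by (simp add: Z_def power2_eq_square algebra_simps)
  qed
  have int: "integrable M (\<lambda>\<omega>. (Z \<omega>)\<^sup>2)" unfolding sq by (simp add: integrable_W_mult)
  have "expectation (\<lambda>\<omega>. (Z \<omega>)\<^sup>2) = h \<bullet> h - 2 * (\<Sum>b\<in>Basis. (h \<bullet> b) * (h \<bullet> b))
      + (\<Sum>b\<in>Basis. \<Sum>c\<in>Basis. ((h \<bullet> b) * (h \<bullet> c)) * (b \<bullet> c))"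
    unfolding sq by (simp add: integrable_W_mult covariance)
  also have "(\<Sum>b\<in>Basis. \<Sum>c\<in>Basis. ((h \<bullet> b) * (h \<bullet> c)) * (b \<bullet> c)) = (\<Sum>b\<in>Basis. (h \<bullet> b) * (h \<bullet> b))"
  proof (rule sum.cong[OF refl])
    fix b :: 'h assume b: "b \<in> Basis"
    have "(\<Sum>c\<in>Basis. ((h \<bullet> b) * (h \<bullet> c)) * (b \<bullet> c)) = (\<Sum>c\<in>Basis. if b = c then (h \<bullet> b) * (h \<bullet> c) else 0)"
      using b by (intro sum.cong) (auto simp: inner_Basis)
    then show "(\<Sum>c\<in>Basis. ((h \<bullet> b) * (h \<bullet> c)) * (b \<bullet> c)) = (h \<bullet> b) * (h \<bullet> b)" using b by simp
  qed
  also have "(\<Sum>b\<in>Basis. (h \<bullet> b) * (h \<bullet> b)) = h \<bullet> h" by (simp flip: euclidean_inner)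
  finally have "expectation (\<lambda>\<omega>. (Z \<omega>)\<^sup>2) = 0" by simp
  then have "AE \<omega> in M. (Z \<omega>)\<^sup>2 = 0"
    using int by (subst (asm) integral_nonneg_eq_0_iff_AE) auto
  then show ?thesis by eventually_elim (simp add: Z_def coords_def)
qed

end

section \<open>The chain rule for iterated partial derivatives\<close>

lemma mean_value_between:
  fixes \<phi> :: "real \<Rightarrow> real"
  assumes d: "\<And>t. (\<phi> has_real_derivative \<phi>' t) (at t)"
  shows "\<exists>\<xi>. \<bar>\<xi> - a\<bar> \<le> \<bar>b - a\<bar> \<and> \<phi> b - \<phi> a = (b - a) * \<phi>' \<xi>"
proof -
  consider "a < b" | "b < a" | "a = b" by linarith
  then show ?thesis
  proof cases
    case 1
    from MVT2[OF 1 d] obtain z where "a < z" "z < b" "\<phi> b - \<phi> a = (b - a) * \<phi>' z" by blast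
    moreover from this have "\<bar>z - a\<bar> \<le> \<bar>b - a\<bar>" by linarith
    ultimately show ?thesis by blast
  next
    case 2
    from MVT2[OF 2 d] obtain z where z: "b < z" "z < a" "\<phi> a - \<phi> b = (a - b) * \<phi>' z" by blast
    have "\<phi> b - \<phi> a = (b - a) * \<phi>' z" using z(3) unfolding left_diff_distrib by linarith
    moreover have "\<bar>z - a\<bar> \<le> \<bar>b - a\<bar>" using z by linarith
    ultimately show ?thesis by blast
  next
    case 3
    then have "\<bar>a - a\<bar> \<le> \<bar>b - a\<bar> \<and> \<phi> b - \<phi> a = (b - a) * \<phi>' a" by simp
    then show ?thesis by blast
  qed
qed

text \<open>The increment of a function in one coordinate, at a base point that moves along with \<open>s\<close>: \<open>K (s, t)\<close>
  is the partial derivative at position \<open>t\<close> of this coordinate, and \<open>\<xi>\<close> comes from the mean value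
  theorem.\<close>

lemma increment_derivative:
  fixes K :: "real \<times> real \<Rightarrow> real" and r :: "real \<Rightarrow> real"
  assumes K: "isCont K (0, y)"
    and r: "\<And>s. \<exists>\<xi>. \<bar>\<xi> - y\<bar> \<le> \<bar>s * d\<bar> \<and> r s = s * d * K (s, \<xi>)"
  shows "(r has_real_derivative d * K (0, y)) (at 0)"
proof -
  from r obtain \<xi> where \<xi>: "\<And>s. \<bar>\<xi> s - y\<bar> \<le> \<bar>s * d\<bar>" "\<And>s. r s = s * d * K (s, \<xi> s)"
    using choice[of "\<lambda>s \<xi>. \<bar>\<xi> - y\<bar> \<le> \<bar>s * d\<bar> \<and> r s = s * d * K (s, \<xi>)"] by blast
  have "((\<lambda>s. \<bar>s * d\<bar>) \<longlongrightarrow> \<bar>0 * d\<bar>) (at 0)" by (intro tendsto_intros)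
  then have lim0: "((\<lambda>s. \<bar>s * d\<bar>) \<longlongrightarrow> 0) (at 0)" by simp
  have "((\<lambda>s. \<xi> s - y) \<longlongrightarrow> 0) (at 0)"
  proof (rule Lim_null_comparison[OF _ lim0])
    show "\<forall>\<^sub>F s in at 0. norm (\<xi> s - y) \<le> \<bar>s * d\<bar>"
      unfolding real_norm_def by (intro always_eventually allI \<xi>(1))
  qed
  then have "(\<xi> \<longlongrightarrow> y) (at 0)" by (simp add: LIM_zero_iff)
  then have "((\<lambda>s. (s, \<xi> s)) \<longlongrightarrow> (0, y)) (at 0)" by (intro tendsto_intros)
  from isCont_tendsto_compose[OF K this]
  have "((\<lambda>s. d * K (s, \<xi> s)) \<longlongrightarrow> d * K (0, y)) (at 0)" by (intro tendsto_intros)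
  then have "((\<lambda>s. (r (0 + s) - r 0) / s) \<longlongrightarrow> d * K (0, y)) (at 0)"
    by (rule Lim_transform_eventually) (auto simp: \<xi>(2) eventually_at_filter)
  then show ?thesis by (simp add: DERIV_def)
qed

text \<open>Continuous partial derivatives give the derivative along a line: the first \<open>j\<close> coordinates are
  moved, and one more coordinate is added in each induction step.\<close>

lemma chain_rule_partial_sums:
  fixes g :: "(nat \<Rightarrow> real) \<Rightarrow> real" and dg :: "nat \<Rightarrow> (nat \<Rightarrow> real) \<Rightarrow> real"
  assumes cont: "\<And>i. i < m \<Longrightarrow> continuous_on UNIV (dg i)"
    and der: "\<And>i x t. i < m \<Longrightarrow> ((\<lambda>t. g (x(i := t))) has_real_derivative dg i (x(i := t))) (at t)"
  shows "j \<le> m \<Longrightarrow> ((\<lambda>s. g (\<lambda>i. if i < j then y i + s * d i else y i)) has_real_derivative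
    (\<Sum>i<j. d i * dg i y)) (at 0)"
proof (induction j)
  case (Suc j)
  then have j: "j < m" by simp
  define z where "z = (\<lambda>s i. if i < j then y i + s * d i else y i)"
  define K where "K = (\<lambda>p. dg j ((z (fst p))(j := snd p)))"
  have z0: "z 0 = y" by (auto simp: z_def)
  have "continuous_on UNIV (\<lambda>p::real \<times> real. (z (fst p))(j := snd p))"
  proof (rule continuous_on_coordinatewise_then_product)
    fix i show "continuous_on UNIV (\<lambda>p::real \<times> real. ((z (fst p))(j := snd p)) i)"
    proof -
      consider "i = j" | "i < j" | "j < i" by linarith
      then show ?thesis
      proof cases
        case 1
        then show ?thesis by (simp add: continuous_on_snd continuous_on_id)
      next
        case 2
        then have "((z (fst p))(j := snd p)) i = y i + fst p * d i" for p by (simp add: z_def)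
        then show ?thesis by (simp add: continuous_on_add continuous_on_mult continuous_on_fst continuous_on_id)
      next
        case 3
        then have "((z (fst p))(j := snd p)) i = y i" for p by (simp add: z_def)
        then show ?thesis by simp
      qed
    qed
  qed
  then have "continuous_on UNIV K"
    unfolding K_def by (rule continuous_on_compose2[OF cont[OF j]]) simp
  then have K: "isCont K (0, y j)" by (simp add: continuous_on_eq_continuous_at)
  have "((\<lambda>s. g ((z s)(j := y j + s * d j)) - g (z s)) has_real_derivative d j * K (0, y j)) (at 0)"
  proof (rule increment_derivative[OF K])
    fix s
    have "(z s)(j := y j) = z s" by (auto simp: z_def)
    then show "\<exists>\<xi>. \<bar>\<xi> - y j\<bar> \<le> \<bar>s * d j\<bar> \<and>
        g ((z s)(j := y j + s * d j)) - g (z s) = s * d j * K (s, \<xi>)"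
      using mean_value_between[OF der[OF j, of "z s"], of "y j" "y j + s * d j"] by (simp add: K_def)
  qed
  moreover have "((\<lambda>s. g (z s)) has_real_derivative (\<Sum>i<j. d i * dg i y)) (at 0)"
    using Suc by (simp add: z_def)
  ultimately have "((\<lambda>s. (g ((z s)(j := y j + s * d j)) - g (z s)) + g (z s)) has_real_derivative
      d j * K (0, y j) + (\<Sum>i<j. d i * dg i y)) (at 0)"
    by (rule DERIV_add)
  moreover have "(z s)(j := y j + s * d j) = (\<lambda>i. if i < Suc j then y i + s * d i else y i)" for s
    by (auto simp: z_def less_Suc_eq)
  ultimately show ?case by (simp add: K_def z0 add.commute)
qed simp

lemma partial_derivs_Cons: "partial_derivs (i # is) f = partial_deriv i (partial_derivs is f)"
  by (simp add: partial_derivs_def)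

lemma partial_derivs_local:
  assumes f: "smooth_fun m f" and "set is \<subseteq> {..<m}" and "\<And>i. i < m \<Longrightarrow> x i = y i"
  shows "partial_derivs is f x = partial_derivs is f y"
  using assms(2,3)
proof (induction "is" arbitrary: x y)
  case Nil
  then show ?case using f unfolding smooth_fun_def partial_derivs_def by simp
next
  case (Cons i "is")
  have "partial_derivs is f (x(i := t)) = partial_derivs is f (y(i := t))" for t
    using Cons by (intro Cons.IH) auto
  moreover have "x i = y i" using Cons by simp
  ultimately show ?case by (simp add: partial_derivs_Cons partial_deriv_def)
qed

lemma partial_derivs_DERIV:
  assumes f: "smooth_fun m f" and "is": "set is \<subseteq> {..<m}" and i: "i < m"
  shows "((\<lambda>t. partial_derivs is f (x(i := t))) has_real_derivative partial_derivs (i # is) f (x(i := t))) (at t)"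
proof -
  have "\<forall>x. (\<lambda>t. partial_derivs is f (x(i := t))) differentiable (at (x i))"
    using f "is" i unfolding smooth_fun_def by blast
  from spec[OF this, of "x(i := t)"]
  have "(\<lambda>t. partial_derivs is f (x(i := t))) differentiable (at t)" by simp
  then show ?thesis
    by (simp add: partial_derivs_Cons partial_deriv_def real_differentiable_def DERIV_deriv_iff_real_differentiable)
qed

lemma partial_derivs_along_line:
  assumes f: "smooth_fun m f" and "is": "set is \<subseteq> {..<m}"
  shows "((\<lambda>t. partial_derivs is f (\<lambda>i. y i + t * d i)) has_real_derivative
    (\<Sum>i<m. d i * partial_derivs (i # is) f (\<lambda>i. y i + t * d i))) (at t)"
proof -
  let ?g = "partial_derivs is f"
  let ?y = "\<lambda>i. y i + t * d i"
  have "((\<lambda>s. ?g (\<lambda>i. if i < m then ?y i + s * d i else ?y i)) has_real_derivative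
    (\<Sum>i<m. d i * partial_derivs (i # is) f ?y)) (at 0)"
  proof (rule chain_rule_partial_sums[of m])
    show "continuous_on UNIV (partial_derivs (i # is) f)" if "i < m" for i
    proof -
      have "set (i # is) \<subseteq> {..<m}" using that "is" by auto
      then show ?thesis using f unfolding smooth_fun_def by blast
    qed
  qed (rule partial_derivs_DERIV[OF f "is"], auto)
  moreover have "?g (\<lambda>i. if i < m then ?y i + s * d i else ?y i) = ?g (\<lambda>i. y i + (s + t) * d i)" for s
    by (rule partial_derivs_local[OF f "is"]) (simp add: algebra_simps)
  ultimately have "((\<lambda>s. ?g (\<lambda>i. y i + (s + t) * d i)) has_real_derivative
    (\<Sum>i<m. d i * partial_derivs (i # is) f ?y)) (at 0)" by simp
  then show ?thesis using DERIV_shift[of "\<lambda>s. ?g (\<lambda>i. y i + s * d i)" _ 0 t] by simp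
qed

definition index_lists :: "nat \<Rightarrow> nat \<Rightarrow> nat list set" where
  "index_lists m l = {is. set is \<subseteq> {..<m} \<and> length is = l}"

lemma finite_index_lists: "finite (index_lists m l)"
  unfolding index_lists_def by (rule finite_lists_length_eq) simp

lemma sum_index_lists_Suc:
  "(\<Sum>is\<in>index_lists m (Suc l). F is) = (\<Sum>i<m. \<Sum>is\<in>index_lists m l. F (i # is))"
proof -
  have "(\<Sum>is\<in>index_lists m (Suc l). F is) = (\<Sum>(i, is)\<in>{..<m} \<times> index_lists m l. F (i # is))"
    by (rule sum.reindex_bij_witness[where j = "\<lambda>is. (hd is, tl is)" and i = "\<lambda>(i, is). i # is"])
      (auto simp: index_lists_def length_Suc_conv)
  then show ?thesis by (simp add: sum.cartesian_product)
qed

section \<open>Integrability of functions of polynomial growth\<close>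

text \<open>The weight against which polynomial growth is measured; it is at least \<open>1\<close>, so its powers
  increase with the exponent.\<close>

definition size_fun :: "('h::euclidean_space \<Rightarrow> real) \<Rightarrow> real" where
  "size_fun x = 1 + (\<Sum>b\<in>Basis. \<bar>x b\<bar>)"

lemma size_fun_ge_1: "1 \<le> size_fun x"
  by (simp add: size_fun_def sum_nonneg)

lemma power_sum_le_card:
  fixes a :: "'i \<Rightarrow> real"
  assumes "finite I" "I \<noteq> {}" "\<And>i. i \<in> I \<Longrightarrow> 0 \<le> a i"
  shows "(\<Sum>i\<in>I. a i) ^ N \<le> real (card I) ^ N * (\<Sum>i\<in>I. a i ^ N)"
proof -
  have "Max (a ` I) \<in> a ` I" using assms by (intro Max_in) auto
  then obtain j where j: "j \<in> I" "a j = Max (a ` I)" by force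
  have "(\<Sum>i\<in>I. a i) \<le> real (card I) * a j"
    using assms j(2) by (intro sum_bounded_above) auto
  then have "(\<Sum>i\<in>I. a i) ^ N \<le> (real (card I) * a j) ^ N"
    using assms by (intro power_mono sum_nonneg) auto
  also have "\<dots> \<le> real (card I) ^ N * (\<Sum>i\<in>I. a i ^ N)"
    unfolding power_mult_distrib using assms j
    by (intro mult_left_mono member_le_sum[where f = "\<lambda>i. a i ^ N"]) auto
  finally show ?thesis .
qed

lemma measurable_coordinate:
  assumes "b \<in> I"
  shows "(\<lambda>x. x b) \<in> borel_measurable (gauss_product I)"
  using measurable_component_singleton[OF assms, of "\<lambda>_. std_normal_distribution"] by simp

lemma measurable_size_fun [measurable]:
  "size_fun \<in> borel_measurable (gauss_product (Basis :: 'h::euclidean_space set))"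
  unfolding size_fun_def[abs_def]
  by (intro borel_measurable_add borel_measurable_sum borel_measurable_abs measurable_coordinate) auto

lemma integrable_size_fun_power:
  "integrable (gauss_product (Basis :: 'h::euclidean_space set)) (\<lambda>x. size_fun x ^ N)"
proof -
  let ?P = "gauss_product (Basis :: 'h set)"
  interpret P: prob_space ?P by (rule prob_space_gauss_product)
  have coord: "integrable ?P (\<lambda>x. \<bar>x b\<bar> ^ N)" if b: "b \<in> Basis" for b
  proof -
    have "distr ?P std_normal_distribution (\<lambda>x. x b) = std_normal_distribution"
      by (rule distr_PiM_component[OF std_normal.prob_space_axioms b])
    moreover have "integrable std_normal_distribution (\<lambda>x. \<bar>x\<bar> ^ N)"
      using integrable_std_normal_moment_abs[of N] by (subst integrable_density) (auto simp: normal_density_nonneg)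
    ultimately have "integrable (distr ?P std_normal_distribution (\<lambda>x. x b)) (\<lambda>x. \<bar>x\<bar> ^ N)" by simp
    then show ?thesis
      using measurable_component_singleton[OF b, of "\<lambda>_. std_normal_distribution"]
      by (subst (asm) integrable_distr_eq) auto
  qed
  show ?thesis
  proof (rule Bochner_Integration.integrable_bound)
    show "integrable ?P (\<lambda>x. 2 ^ N * (1 + real DIM('h) ^ N * (\<Sum>b\<in>Basis. \<bar>x b\<bar> ^ N)))"
      using coord by simp
    have bound: "size_fun x ^ N \<le> 2 ^ N * (1 + real DIM('h) ^ N * (\<Sum>b\<in>Basis. \<bar>x b\<bar> ^ N))" for x :: "'h \<Rightarrow> real"
    proof -
      define t where "t = (\<Sum>b\<in>Basis. \<bar>x b\<bar>)"
      have t: "t \<ge> 0" by (simp add: t_def sum_nonneg)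
      have "(1 + t) ^ N \<le> (2 * max 1 t) ^ N" using t by (intro power_mono) auto
      also have "\<dots> \<le> 2 ^ N * (1 + t ^ N)"
        using t by (simp add: power_mult_distrib max_def)
      also have "\<dots> \<le> 2 ^ N * (1 + real DIM('h) ^ N * (\<Sum>b\<in>Basis. \<bar>x b\<bar> ^ N))"
        unfolding t_def by (intro mult_left_mono add_left_mono power_sum_le_card) auto
      finally show ?thesis by (simp add: size_fun_def t_def)
    qed
    show "AE x in ?P. norm (size_fun x ^ N) \<le> norm (2 ^ N * (1 + real DIM('h) ^ N * (\<Sum>b\<in>Basis. \<bar>x b\<bar> ^ N)))"
    proof (intro AE_I2)
      fix x :: "'h \<Rightarrow> real"
      have "0 \<le> size_fun x ^ N" using size_fun_ge_1[of x] by (intro zero_le_power) linarith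
      with bound[of x] show "norm (size_fun x ^ N) \<le> norm (2 ^ N * (1 + real DIM('h) ^ N * (\<Sum>b\<in>Basis. \<bar>x b\<bar> ^ N)))"
        unfolding real_norm_def by linarith
    qed
  qed measurable
qed

definition poly_bounded :: "(('h::euclidean_space \<Rightarrow> real) \<Rightarrow> real) \<Rightarrow> bool" where
  "poly_bounded f \<longleftrightarrow> (\<exists>c p. \<forall>x. \<bar>f x\<bar> \<le> c * size_fun x ^ p)"

lemma poly_bounded_add:
  assumes "poly_bounded f" "poly_bounded g"
  shows "poly_bounded (\<lambda>x. f x + g x)"
proof -
  from assms obtain c p c' p' where f: "\<And>x. \<bar>f x\<bar> \<le> c * size_fun x ^ p"
    and g: "\<And>x. \<bar>g x\<bar> \<le> c' * size_fun x ^ p'" by (auto simp: poly_bounded_def)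
  have "\<bar>f x + g x\<bar> \<le> (\<bar>c\<bar> + \<bar>c'\<bar>) * size_fun x ^ (p + p')" for x
  proof -
    have "c * size_fun x ^ p \<le> \<bar>c\<bar> * size_fun x ^ (p + p')" "c' * size_fun x ^ p' \<le> \<bar>c'\<bar> * size_fun x ^ (p + p')"
      using size_fun_ge_1[of x] by (intro mult_mono power_increasing; simp)+
    then show ?thesis using f[of x] g[of x] unfolding distrib_right by linarith
  qed
  then show ?thesis by (auto simp: poly_bounded_def)
qed

lemma poly_bounded_mono:
  assumes "poly_bounded g" "\<And>x. \<bar>f x\<bar> \<le> c * \<bar>g x\<bar>" "c \<ge> 0"
  shows "poly_bounded f"
proof -
  from assms(1) obtain c' p where g: "\<And>x. \<bar>g x\<bar> \<le> c' * size_fun x ^ p" by (auto simp: poly_bounded_def)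
  have "\<bar>f x\<bar> \<le> (c * c') * size_fun x ^ p" for x
    using assms(2)[of x] mult_left_mono[OF g[of x] assms(3)] by simp
  then show ?thesis by (auto simp: poly_bounded_def)
qed

lemma poly_bounded_sum:
  assumes "finite I" "\<And>i. i \<in> I \<Longrightarrow> poly_bounded (f i)"
  shows "poly_bounded (\<lambda>x. \<Sum>i\<in>I. f i x)"
  using assms
proof (induction I)
  case empty
  show ?case by (auto simp: poly_bounded_def intro!: exI[of _ 0])
qed (simp add: poly_bounded_add)

lemma integrable_poly_bounded_powr:
  fixes f :: "('h::euclidean_space \<Rightarrow> real) \<Rightarrow> real"
  assumes f: "poly_bounded f" and [measurable]: "f \<in> borel_measurable (gauss_product Basis)"
    and f0: "\<And>x. 0 \<le> f x" and q: "q \<ge> 1"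
  shows "integrable (gauss_product Basis) (\<lambda>x. f x powr q)"
proof -
  from f obtain c p where c: "\<And>x. \<bar>f x\<bar> \<le> c * size_fun x ^ p" by (auto simp: poly_bounded_def)
  define N where "N = nat \<lceil>real p * q\<rceil>"
  have N: "real p * q \<le> real N" unfolding N_def by linarith
  show ?thesis
  proof (rule Bochner_Integration.integrable_bound)
    show "integrable (gauss_product Basis) (\<lambda>x. \<bar>c\<bar> powr q * size_fun (x :: 'h \<Rightarrow> real) ^ N)"
      by (intro integrable_mult_right integrable_size_fun_power)
    have bound: "f x powr q \<le> \<bar>c\<bar> powr q * size_fun x ^ N" for x
    proof -
      have s: "size_fun x > 0" using size_fun_ge_1[of x] by linarith
      have "f x \<le> \<bar>c\<bar> * size_fun x ^ p"
      proof -
        have "c * size_fun x ^ p \<le> \<bar>c\<bar> * size_fun x ^ p" using s by (intro mult_right_mono) auto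
        with c[of x] show ?thesis by linarith
      qed
      then have "f x powr q \<le> (\<bar>c\<bar> * size_fun x ^ p) powr q" using f0 q by (intro powr_mono2) auto
      also have "\<dots> = \<bar>c\<bar> powr q * size_fun x powr (real p * q)"
        unfolding powr_realpow[OF s, symmetric] by (simp only: powr_mult powr_powr)
      also have "\<dots> \<le> \<bar>c\<bar> powr q * size_fun x powr real N"
        using size_fun_ge_1[of x] N by (intro mult_left_mono powr_mono) auto
      finally show ?thesis using s by (simp add: powr_realpow)
    qed
    show "AE x in gauss_product Basis. norm (f x powr q) \<le> norm (\<bar>c\<bar> powr q * size_fun x ^ N)"
    proof (intro AE_I2)
      fix x :: "'h \<Rightarrow> real"
      have "0 \<le> f x powr q" by simp
      with bound[of x] show "norm (f x powr q) \<le> norm (\<bar>c\<bar> powr q * size_fun x ^ N)"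
        unfolding real_norm_def by linarith
    qed
  qed measurable
qed

section \<open>Malliavin derivatives as derivatives on \<open>\<real>\<^sup>n\<close>\<close>

text \<open>The arguments \<open>\<langle>h\<^sub>i, x\<rangle>\<close> at which a representing function is evaluated, as a function of the
  coordinates of \<open>x\<close>.\<close>

definition coord_map :: "(nat \<Rightarrow> 'h::euclidean_space) \<Rightarrow> ('h \<Rightarrow> real) \<Rightarrow> nat \<Rightarrow> real" where
  "coord_map h x = (\<lambda>i. \<Sum>b\<in>Basis. (h i \<bullet> b) * x b)"

lemma coord_map_fun_upd:
  assumes "c \<in> Basis"
  shows "coord_map h (x(c := t)) = (\<lambda>i. coord_map h (x(c := 0)) i + t * (h i \<bullet> c))"
proof
  fix i
  have "(\<Sum>b\<in>Basis. (h i \<bullet> b) * (x(c := t)) b)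
      = (\<Sum>b\<in>Basis. (h i \<bullet> b) * (x(c := 0)) b + (if b = c then t * (h i \<bullet> c) else 0))"
    by (intro sum.cong) auto
  then show "coord_map h (x(c := t)) i = coord_map h (x(c := 0)) i + t * (h i \<bullet> c)"
    using assms by (simp add: coord_map_def sum.distrib)
qed

lemma poly_bounded_coord_map:
  fixes h :: "nat \<Rightarrow> 'h::euclidean_space"
  assumes "polynomial_growth m g"
  shows "poly_bounded (\<lambda>x. g (coord_map h x))"
proof -
  from assms obtain c p where g: "\<And>y. \<bar>g y\<bar> \<le> c * (1 + L2_set y {..<m}) ^ p"
    by (auto simp: polynomial_growth_def)
  define K where "K = 1 + (\<Sum>i<m. \<Sum>b\<in>Basis. \<bar>h i \<bullet> b\<bar>)"
  have K: "K \<ge> 1" by (simp add: K_def sum_nonneg)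
  have "\<bar>g (coord_map h x)\<bar> \<le> (\<bar>c\<bar> * K ^ p) * size_fun x ^ p" for x
  proof -
    have s: "1 \<le> size_fun x" by (rule size_fun_ge_1)
    have xb: "\<bar>x b\<bar> \<le> size_fun x" if "b \<in> Basis" for b
      using member_le_sum[OF that, of "\<lambda>b. \<bar>x b\<bar>"] by (simp add: size_fun_def)
    have "L2_set (coord_map h x) {..<m} \<le> (\<Sum>i<m. \<bar>coord_map h x i\<bar>)" by (rule L2_set_le_sum_abs)
    also have "\<dots> \<le> (\<Sum>i<m. \<Sum>b\<in>Basis. \<bar>h i \<bullet> b\<bar> * size_fun x)"
      unfolding coord_map_def
      by (intro sum_mono order_trans[OF sum_abs]) (auto simp: abs_mult intro!: sum_mono mult_left_mono xb)
    also have "\<dots> = (\<Sum>i<m. \<Sum>b\<in>Basis. \<bar>h i \<bullet> b\<bar>) * size_fun x" by (simp add: sum_distrib_right)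
    finally have "1 + L2_set (coord_map h x) {..<m} \<le> K * size_fun x"
      using s by (simp add: K_def distrib_right)
    then have "(1 + L2_set (coord_map h x) {..<m}) ^ p \<le> (K * size_fun x) ^ p"
      by (intro power_mono) (auto simp: L2_set_nonneg)
    then have "\<bar>c\<bar> * (1 + L2_set (coord_map h x) {..<m}) ^ p \<le> \<bar>c\<bar> * (K * size_fun x) ^ p"
      by (rule mult_left_mono) simp
    moreover have "c * (1 + L2_set (coord_map h x) {..<m}) ^ p \<le> \<bar>c\<bar> * (1 + L2_set (coord_map h x) {..<m}) ^ p"
      by (intro mult_right_mono) (auto simp: L2_set_nonneg)
    ultimately show ?thesis using g[of "coord_map h x"] by (simp add: power_mult_distrib mult_ac)
  qed
  then show ?thesis by (auto simp: poly_bounded_def)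
qed

text \<open>The data that represent a vector-valued smooth random variable, where the \<open>j\<close>-th coefficient is
  \<open>f j (W (h j 0), \<dots>, W (h j (m j - 1)))\<close> and multiplies the vector \<open>v j\<close>.\<close>

locale smooth_vector_data =
  fixes J :: nat and m :: "nat \<Rightarrow> nat" and h :: "nat \<Rightarrow> nat \<Rightarrow> 'h::euclidean_space"
    and f :: "nat \<Rightarrow> (nat \<Rightarrow> real) \<Rightarrow> real" and v :: "nat \<Rightarrow> 'v::{real_inner, second_countable_topology}"
  assumes smooth: "j < J \<Longrightarrow> smooth_poly_growth (m j) (f j)"
begin

text \<open>The derivative tensor as a function of the arguments \<open>y j i\<close> of the representing functions. The
  Malliavin derivative inserts \<open>W (h j i)\<close>, and the derivative of a function on \<open>\<real>\<^sup>n\<close> inserts the linear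
  forms \<open>\<langle>h j i, x\<rangle>\<close>; both are needed, since they agree only almost surely.\<close>

definition tensor_at :: "nat \<Rightarrow> (nat \<Rightarrow> nat \<Rightarrow> real) \<Rightarrow> 'h list \<Rightarrow> 'v" where
  "tensor_at l y = (\<lambda>xs. \<Sum>j<J. tensor_vec (\<lambda>xs. \<Sum>is\<in>index_lists (m j) l.
     partial_derivs is (f j) (y j) * elementary_tensor (map (h j) is) xs) (v j) xs)"

definition deriv_at :: "nat \<Rightarrow> ('h \<Rightarrow> real) \<Rightarrow> 'h list \<Rightarrow> 'v" where
  "deriv_at l x = tensor_at l (\<lambda>j. coord_map (h j) x)"

lemma tensor_at_0: "tensor_at 0 y [] = (\<Sum>j<J. f j (y j) *\<^sub>R v j)"
proof -
  have "index_lists (m j) 0 = {[]}" for j by (auto simp: index_lists_def)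
  then show ?thesis by (simp add: tensor_at_def tensor_vec_def partial_derivs_def)
qed

lemma measurable_tensor_at:
  assumes y: "\<And>j i. (\<lambda>\<omega>. y \<omega> j i) \<in> borel_measurable M"
  shows "(\<lambda>\<omega>. tensor_norm l (tensor_at l (y \<omega>))) \<in> borel_measurable M"
proof -
  have pd [measurable]: "(\<lambda>\<omega>. partial_derivs is (f j) (y \<omega> j)) \<in> borel_measurable M"
    if "j \<in> {..<J}" "is \<in> index_lists (m j) l" for j "is"
  proof (rule measurable_compose[of "\<lambda>\<omega>. y \<omega> j" M borel])
    show "(\<lambda>\<omega>. y \<omega> j) \<in> borel_measurable M"
      by (rule measurable_coordinatewise_then_product) (rule y)
    have "continuous_on UNIV (partial_derivs is (f j))"
      using smooth[of j] that by (auto simp: smooth_poly_growth_def smooth_fun_def index_lists_def)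
    then show "partial_derivs is (f j) \<in> borel_measurable borel"
      by (rule borel_measurable_continuous_onI)
  qed
  show ?thesis
    unfolding tensor_norm_eq_L2_set L2_set_def tensor_at_def tensor_vec_def
    by measurable
qed

lemma deriv_at_derivative:
  assumes c: "c \<in> Basis"
  shows "((\<lambda>t. deriv_at l (x(c := t)) bs) has_vector_derivative deriv_at (Suc l) (x(c := t)) (c # bs)) (at t)"
proof -
  let ?y = "\<lambda>j t. coord_map (h j) (x(c := t))"
  have "((\<lambda>t. \<Sum>is\<in>index_lists (m j) l. partial_derivs is (f j) (?y j t) * elementary_tensor (map (h j) is) bs)
      has_real_derivative
      (\<Sum>is\<in>index_lists (m j) (Suc l). partial_derivs is (f j) (?y j t) * elementary_tensor (map (h j) is) (c # bs))) (at t)"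
    if j: "j < J" for j
  proof -
    have "((\<lambda>t. \<Sum>is\<in>index_lists (m j) l. partial_derivs is (f j) (?y j t) * elementary_tensor (map (h j) is) bs)
      has_real_derivative (\<Sum>is\<in>index_lists (m j) l. (\<Sum>i<m j. (h j i \<bullet> c) * partial_derivs (i # is) (f j) (?y j t))
        * elementary_tensor (map (h j) is) bs)) (at t)"
    proof (rule DERIV_sum, rule DERIV_cmult_right)
      define y0 where "y0 = coord_map (h j) (x(c := 0))"
      have y: "?y j t = (\<lambda>i. y0 i + t * (h j i \<bullet> c))" for t
        unfolding y0_def by (rule coord_map_fun_upd[OF c])
      fix "is" assume "is \<in> index_lists (m j) l"
      then show "((\<lambda>t. partial_derivs is (f j) (?y j t)) has_real_derivative
          (\<Sum>i<m j. (h j i \<bullet> c) * partial_derivs (i # is) (f j) (?y j t))) (at t)"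
        unfolding y using smooth[OF j]
        by (intro partial_derivs_along_line) (auto simp: smooth_poly_growth_def index_lists_def)
    qed
    also have "(\<Sum>is\<in>index_lists (m j) l. (\<Sum>i<m j. (h j i \<bullet> c) * partial_derivs (i # is) (f j) (?y j t))
        * elementary_tensor (map (h j) is) bs)
      = (\<Sum>is\<in>index_lists (m j) (Suc l). partial_derivs is (f j) (?y j t) * elementary_tensor (map (h j) is) (c # bs))"
      unfolding sum_index_lists_Suc sum_distrib_right
      by (subst sum.swap) (simp add: mult_ac)
    finally show ?thesis .
  qed
  then show ?thesis
    unfolding deriv_at_def tensor_at_def tensor_vec_def has_real_derivative_iff_has_vector_derivative
    by (intro has_vector_derivative_sum bounded_linear.has_vector_derivative[OF bounded_linear_scaleR_left]) auto
qed

lemma measurable_deriv_at: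
  "(\<lambda>x. tensor_norm l (deriv_at l x)) \<in> borel_measurable (gauss_product Basis)"
  unfolding deriv_at_def coord_map_def
  by (intro measurable_tensor_at borel_measurable_sum borel_measurable_times borel_measurable_const measurable_coordinate)

lemma poly_bounded_deriv_at: "poly_bounded (\<lambda>x. tensor_norm l (deriv_at l x))"
proof (rule poly_bounded_mono[where c = 1])
  let ?B = "\<lambda>x. \<Sum>bs\<in>(basis_lists l :: 'h list set). \<Sum>j<J. (\<Sum>is\<in>index_lists (m j) l.
    \<bar>partial_derivs is (f j) (coord_map (h j) x)\<bar> * \<bar>elementary_tensor (map (h j) is) bs\<bar>) * norm (v j)"
  show "poly_bounded ?B"
    unfolding sum_distrib_right
  proof (intro poly_bounded_sum finite_basis_lists finite_lessThan finite_index_lists)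
    fix bs :: "'h list" and j "is" assume "j \<in> {..<J}" "is \<in> index_lists (m j) l"
    then have "poly_bounded (\<lambda>x. partial_derivs is (f j) (coord_map (h j) x))"
      using smooth[of j] by (intro poly_bounded_coord_map) (auto simp: smooth_poly_growth_def index_lists_def)
    then show "poly_bounded (\<lambda>x. \<bar>partial_derivs is (f j) (coord_map (h j) x)\<bar> *
        \<bar>elementary_tensor (map (h j) is) bs\<bar> * norm (v j))"
      by (rule poly_bounded_mono[where c = "\<bar>elementary_tensor (map (h j) is) bs\<bar> * norm (v j)"])
        (simp_all add: abs_mult)
  qed
  fix x
  have "tensor_norm l (deriv_at l x) \<le> (\<Sum>bs\<in>(basis_lists l :: 'h list set). norm (deriv_at l x bs))"
    unfolding tensor_norm_eq_L2_set by (rule L2_set_le_sum) simp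
  also have "\<dots> \<le> ?B x"
    unfolding deriv_at_def tensor_at_def tensor_vec_def
  proof (intro sum_mono order_trans[OF norm_sum])
    fix bs :: "'h list" and j
    have "\<bar>\<Sum>is\<in>index_lists (m j) l. partial_derivs is (f j) (coord_map (h j) x) * elementary_tensor (map (h j) is) bs\<bar>
      \<le> (\<Sum>is\<in>index_lists (m j) l. \<bar>partial_derivs is (f j) (coord_map (h j) x)\<bar> * \<bar>elementary_tensor (map (h j) is) bs\<bar>)"
      unfolding abs_mult[symmetric] by (rule sum_abs)
    then show "norm ((\<Sum>is\<in>index_lists (m j) l. partial_derivs is (f j) (coord_map (h j) x) * elementary_tensor (map (h j) is) bs) *\<^sub>R v j)
      \<le> (\<Sum>is\<in>index_lists (m j) l. \<bar>partial_derivs is (f j) (coord_map (h j) x)\<bar> * \<bar>elementary_tensor (map (h j) is) bs\<bar>) * norm (v j)"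
      unfolding norm_scaleR by (rule mult_right_mono) simp
  qed
  finally show "\<bar>tensor_norm l (deriv_at l x)\<bar> \<le> 1 * \<bar>?B x\<bar>" by simp
qed simp

lemma gaussian_derivative_tower_deriv_at:
  assumes "q \<ge> 1"
  shows "gaussian_derivative_tower deriv_at q"
proof
  show "integrable (gauss_product Basis) (\<lambda>x. tensor_norm l (deriv_at l x) powr q)" for l
    using assms by (intro integrable_poly_bounded_powr poly_bounded_deriv_at measurable_deriv_at) auto
qed (use assms deriv_at_derivative measurable_deriv_at in auto)

end

lemma Lq_norm_cong_AE:
  assumes "AE \<omega> in M. N (G \<omega>) = N' (G' \<omega>)"
    and "(\<lambda>\<omega>. N (G \<omega>)) \<in> borel_measurable M" "(\<lambda>\<omega>. N' (G' \<omega>)) \<in> borel_measurable M"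
  shows "Lq_norm M q N G = Lq_norm M q N' G'"
proof -
  have "(\<integral>\<omega>. N (G \<omega>) powr q \<partial>M) = (\<integral>\<omega>. N' (G' \<omega>) powr q \<partial>M)"
    using assms by (intro integral_cong_AE) auto
  then show ?thesis by (simp add: Lq_norm_def)
qed

context finite_dim_isonormal
begin

text \<open>Passage from the probability space to \<open>\<real>\<^sup>n\<close>. The representation that defines the Malliavin
  derivatives is chosen independently of their order, so that one choice yields derivative tensors
  of a single function in every order, whatever the choice is.\<close>

lemma malliavin_tower:
  fixes F :: "'a \<Rightarrow> 'v::{real_inner, second_countable_topology}"
  assumes F: "F \<in> smooth_vec_rvs M W" and q: "q \<ge> 1"
  obtains D :: "nat \<Rightarrow> ('h \<Rightarrow> real) \<Rightarrow> 'h list \<Rightarrow> 'v" where "gaussian_derivative_tower D q"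
    and "Lq_norm M q norm F = gaussian_derivative_tower.seminorm D q 0"
    and "\<And>l. Lq_norm M q (tensor_norm l) (malliavin_deriv_vec M W l F) = gaussian_derivative_tower.seminorm D q l"
proof -
  define r where "r = (SOME r. smooth_vec_rep M W F r)"
  obtain J G v where r: "r = (J, G, v)" by (cases r)
  have "smooth_vec_rep M W F r"
    using F unfolding smooth_vec_rvs_def r_def by (auto intro: someI_ex)
  then have G: "\<And>j. j < J \<Longrightarrow> G j \<in> smooth_rvs M W"
    and F_eq: "\<And>\<omega>. \<omega> \<in> space M \<Longrightarrow> F \<omega> = (\<Sum>j<J. G j \<omega> *\<^sub>R v j)"
    by (auto simp: r smooth_vec_rep_def)
  define \<rho> where "\<rho> = (\<lambda>j. SOME r. smooth_rep M W (G j) r)"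
  define m where "m = (\<lambda>j. fst (\<rho> j))"
  define h where "h = (\<lambda>j. fst (snd (\<rho> j)))"
  define f where "f = (\<lambda>j. snd (snd (\<rho> j)))"
  have \<rho>: "\<rho> j = (m j, h j, f j)" for j by (simp add: m_def h_def f_def)
  have rep: "smooth_rep M W (G j) (m j, h j, f j)" if "j < J" for j
    using G[OF that] unfolding smooth_rvs_def \<rho>[symmetric] \<rho>_def by (auto intro: someI_ex)
  interpret smooth_vector_data J m h f v
    by unfold_locales (use rep in \<open>auto simp: smooth_rep_def\<close>)
  interpret tower: gaussian_derivative_tower deriv_at q
    by (rule gaussian_derivative_tower_deriv_at[OF q])
  let ?y = "\<lambda>\<omega> j i. W (h j i) \<omega>"
  have mal: "malliavin_deriv_vec M W l F \<omega> = tensor_at l (?y \<omega>)" for l \<omega>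
  proof -
    have "malliavin_deriv M W l (G j) \<omega> = (\<lambda>xs. \<Sum>is\<in>index_lists (m j) l.
        partial_derivs is (f j) (?y \<omega> j) * elementary_tensor (map (h j) is) xs)" for j
      unfolding malliavin_deriv_def \<rho>_def[symmetric, THEN fun_cong, simplified] \<rho>
      by (simp add: index_lists_def)
    then show ?thesis
      by (simp add: malliavin_deriv_vec_def r tensor_at_def flip: r_def)
  qed
  have F_at: "F \<omega> = tensor_at 0 (?y \<omega>) []" if "\<omega> \<in> space M" for \<omega>
    unfolding F_eq[OF that] tensor_at_0 using rep that by (intro sum.cong) (auto simp: smooth_rep_def)
  have "AE \<omega> in M. \<forall>j i. W (h j i) \<omega> = (\<Sum>b\<in>Basis. (h j i \<bullet> b) * coords \<omega> b)"
    unfolding AE_all_countable using W_expansion by blast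
  then have y_ae: "AE \<omega> in M. ?y \<omega> = (\<lambda>j. coord_map (h j) (coords \<omega>))"
    by eventually_elim (simp add: coord_map_def fun_eq_iff)
  have y_meas: "(\<lambda>\<omega>. tensor_norm l (tensor_at l (?y \<omega>))) \<in> borel_measurable M" for l
    by (rule measurable_tensor_at) simp
  have transfer: "Lq_norm M q (\<lambda>x. x) (\<lambda>\<omega>. tensor_norm l (tensor_at l (?y \<omega>))) = tower.seminorm l" for l
  proof -
    have "Lq_norm M q (\<lambda>x. x) (\<lambda>\<omega>. tensor_norm l (tensor_at l (?y \<omega>)))
        = Lq_norm M q (\<lambda>x. x) (\<lambda>\<omega>. tensor_norm l (deriv_at l (coords \<omega>)))"
    proof (rule Lq_norm_cong_AE)
      show "AE \<omega> in M. tensor_norm l (tensor_at l (?y \<omega>)) = tensor_norm l (deriv_at l (coords \<omega>))"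
        using y_ae by eventually_elim (simp add: deriv_at_def)
      show "(\<lambda>\<omega>. tensor_norm l (deriv_at l (coords \<omega>))) \<in> borel_measurable M"
        by (rule measurable_compose[OF measurable_coords measurable_deriv_at])
    qed (rule y_meas)
    also have "\<dots> = (\<integral>x. tensor_norm l (deriv_at l x) powr q \<partial>distr M (gauss_product Basis) coords) powr (1 / q)"
      unfolding Lq_norm_def using measurable_deriv_at by (subst integral_distr[OF measurable_coords]) auto
    also have "\<dots> = tower.seminorm l"
      by (simp add: coords_distribution tower.seminorm_def Lq_norm_def)
    finally show ?thesis .
  qed
  show ?thesis
  proof (rule that[OF tower.gaussian_derivative_tower_axioms])
    show "Lq_norm M q (tensor_norm l) (malliavin_deriv_vec M W l F) = tower.seminorm l" for l
      unfolding transfer[symmetric] Lq_norm_def mal ..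
    have "tensor_norm 0 T = norm (T [])" for T :: "'h list \<Rightarrow> 'v"
      by (simp add: tensor_norm_eq_L2_set basis_lists_0)
    then have "(\<integral>\<omega>. norm (F \<omega>) powr q \<partial>M) = (\<integral>\<omega>. tensor_norm 0 (tensor_at 0 (?y \<omega>)) powr q \<partial>M)"
      by (intro Bochner_Integration.integral_cong) (simp_all add: F_at)
    then show "Lq_norm M q norm F = tower.seminorm 0"
      unfolding transfer[symmetric] Lq_norm_def by simp
  qed
qed

lemma graph_sobolev_inequalities:
  fixes F :: "'a \<Rightarrow> 'v::{real_inner, second_countable_topology}"
  assumes F: "F \<in> smooth_vec_rvs M W" and k: "k \<ge> 2" and q: "q \<ge> 1"
  shows "2 powr (1 / q - 1) * graph_norm M W k q F \<le> sobolev_norm M W k q F"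
    and "0 < \<epsilon> \<Longrightarrow> \<epsilon> < 1 \<Longrightarrow> sobolev_norm M W k q F \<le>
      2 ^ (k + 1) * sobolev_const (k - 1) DIM('h) ^ k / \<epsilon> ^ (k - 1) * Lq_norm M q norm F
        + (1 + \<epsilon>) * Lq_norm M q (tensor_norm k) (malliavin_deriv_vec M W k F)"
proof -
  obtain D :: "nat \<Rightarrow> ('h \<Rightarrow> real) \<Rightarrow> 'h list \<Rightarrow> 'v" where D: "gaussian_derivative_tower D q"
    and F0: "Lq_norm M q norm F = gaussian_derivative_tower.seminorm D q 0"
    and Fl: "\<And>l. Lq_norm M q (tensor_norm l) (malliavin_deriv_vec M W l F) = gaussian_derivative_tower.seminorm D q l"
    by (rule malliavin_tower[OF F q]) (rule that)
  interpret gaussian_derivative_tower D q by (rule D)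
  let ?a = seminorm
  have graph: "graph_norm M W k q F = ?a 0 + ?a k" by (simp add: graph_norm_def F0 Fl)
  have "{1..k} = insert k {1..k-1}" using k by auto
  then have sob: "sobolev_norm M W k q F = (?a 0 powr q + (\<Sum>l=1..k-1. ?a l powr q) + ?a k powr q) powr (1 / q)"
    using k by (simp add: sobolev_norm_def F0 Fl algebra_simps)
  show "2 powr (1 / q - 1) * graph_norm M W k q F \<le> sobolev_norm M W k q F"
    unfolding graph sob using q by (intro half_power_mean_le seminorm_nonneg sum_nonneg) auto
  assume \<epsilon>: "0 < \<epsilon>" "\<epsilon> < 1"
  let ?C = "18 * sqrt (exp 1) * real DIM('h)"
  have "{..k} = insert 0 {1..k}" by auto
  then have "sobolev_norm M W k q F = (\<Sum>l\<le>k. ?a l powr q) powr (1 / q)"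
    by (simp add: sobolev_norm_def F0 Fl)
  also have "\<dots> \<le> (\<Sum>l\<le>k. ?a l)" using q by (intro powr_sum_le_sum seminorm_nonneg) auto
  also have "\<dots> = (\<Sum>l<k. ?a l) + ?a k" by (simp flip: lessThan_Suc_atMost)
  also have "(\<Sum>l<k. ?a l) \<le> 2 ^ (k + 1) * ?C ^ ((k - 1) * k) / \<epsilon> ^ (k - 1) * ?a 0 + \<epsilon> * ?a k"
    using k \<epsilon> by (intro seminorm_interpolation) auto
  also have "2 ^ (k + 1) * ?C ^ ((k - 1) * k) / \<epsilon> ^ (k - 1) * ?a 0
      \<le> 2 ^ (k + 1) * sobolev_const (k - 1) DIM('h) ^ k / \<epsilon> ^ (k - 1) * ?a 0"
  proof (intro mult_right_mono divide_right_mono mult_left_mono seminorm_nonneg)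
    show "?C ^ ((k - 1) * k) \<le> sobolev_const (k - 1) DIM('h) ^ k"
      unfolding power_mult using k by (intro power_mono sobolev_const_ge) (auto simp: Suc_leI)
  qed (use \<epsilon> in auto)
  finally show "sobolev_norm M W k q F \<le>
      2 ^ (k + 1) * sobolev_const (k - 1) DIM('h) ^ k / \<epsilon> ^ (k - 1) * Lq_norm M q norm F
        + (1 + \<epsilon>) * Lq_norm M q (tensor_norm k) (malliavin_deriv_vec M W k F)"
    unfolding F0 Fl by (simp add: algebra_simps)
qed

end

theorem theorem2p4:
  fixes M :: "'a measure"
    and W :: "'h::euclidean_space \<Rightarrow> 'a \<Rightarrow> real"
    and k n :: nat and q :: real
  assumes "isonormal_gaussian M W"
    and "k \<ge> 2" and "q \<ge> 1" and "n = DIM('h)"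
  shows "(\<exists>a>0. \<exists>b>0. \<forall>F \<in> (smooth_vec_rvs M W ::
             ('a \<Rightarrow> 'v::{real_inner, complete_space, second_countable_topology}) set).
           a * graph_norm M W k q F \<le> sobolev_norm M W k q F \<and>
           sobolev_norm M W k q F \<le> b * graph_norm M W k q F)
       \<and> (\<forall>F \<in> (smooth_vec_rvs M W :: ('a \<Rightarrow> 'v) set). \<forall>\<epsilon>. 0 < \<epsilon> \<and> \<epsilon> < 1 \<longrightarrow>
           2 powr (1 / q - 1) * graph_norm M W k q F \<le> sobolev_norm M W k q F \<and>
           sobolev_norm M W k q F \<le>
             2 ^ (k + 1) * sobolev_const (k - 1) n ^ k / \<epsilon> ^ (k - 1) * Lq_norm M q norm F
             + (1 + \<epsilon>) * Lq_norm M q (tensor_norm k) (malliavin_deriv_vec M W k F))"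
proof -
  interpret isonormal_gaussian M W by fact
  interpret finite_dim_isonormal M W by unfold_locales
  note ineq = graph_sobolev_inequalities[where 'v = 'v, OF _ assms(2,3)]
  define K where "K = 2 ^ (k + 1) * sobolev_const (k - 1) n ^ k / (1 / 2) ^ (k - 1)"
  define b where "b = max K (3 / 2)"
  have upper: "sobolev_norm M W k q F \<le> b * graph_norm M W k q F"
    if F: "F \<in> (smooth_vec_rvs M W :: ('a \<Rightarrow> 'v) set)" for F
  proof -
    have "sobolev_norm M W k q F \<le> K * Lq_norm M q norm F
        + 3 / 2 * Lq_norm M q (tensor_norm k) (malliavin_deriv_vec M W k F)"
      using ineq(2)[OF F, of "1 / 2"] by (simp add: K_def assms(4))
    also have "\<dots> \<le> b * Lq_norm M q norm F + b * Lq_norm M q (tensor_norm k) (malliavin_deriv_vec M W k F)"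
      by (intro add_mono mult_right_mono) (auto simp: b_def Lq_norm_def)
    finally show ?thesis by (simp add: graph_norm_def distrib_left)
  qed
  have pos: "(0::real) < 2 powr (1 / q - 1)" "0 < b" by (auto simp: b_def)
  show ?thesis
  proof (intro conjI ballI allI impI)
    show "\<exists>a>0. \<exists>b>0. \<forall>F \<in> (smooth_vec_rvs M W :: ('a \<Rightarrow> 'v) set).
        a * graph_norm M W k q F \<le> sobolev_norm M W k q F \<and> sobolev_norm M W k q F \<le> b * graph_norm M W k q F"
      using pos ineq(1) upper by blast
  qed (use ineq assms(4) in auto)
qed

end
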